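(* Let $p$ be an odd prime and let $G = D_p = \langle a, b \mid a^p = b^2 = 1,\ bab = a^{-1}\rangle$ be the dihedral group of order $2p$. Let $k > 0$ be an even integer. Then there is no finite $G$-CW complex $X$ homotopy equivalent to $S^{2k}$, with $X^G = \emptyset$, such that the $G$-action on $X$ is effective, pseudofree, and induces the identity on homology.
   Context: An action of a finite group $G$ on a space $X$ is called pseudofree if it is free outside of a discrete set of points, i.e. the set of points with non-trivial isotropy group is discrete. $X^G$ denotes the set of points of $X$ fixed by all of $G$. The homotopy equivalence $X \simeq S^{2k}$ is non-equivariant. The action induces the identity on homology if every $g \in G$ acts as the identity on $H_*(X;\mathbb{Z})$. *)

theory Defs
  imports "HOL-Homology.Homology" "HOL-Algebra.Group_Action" "HOL-Algebra.Left_Coset"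
    "HOL-Computational_Algebra.Primes"
begin

(* Generators, relations and the order together pin down the group presented by
   <a, b | a^n = b^2 = 1, bab = a^{-1}>: the presented group has order 2n, so a quotient of it
   of order 2n is the whole group. *)
definition dihedral_group :: "nat \<Rightarrow> ('g, 'm) monoid_scheme \<Rightarrow> 'g \<Rightarrow> 'g \<Rightarrow> bool" where
  "dihedral_group n G a b \<longleftrightarrow>
     group G \<and> a \<in> carrier G \<and> b \<in> carrier G \<and>
     generate G {a, b} = carrier G \<and>
     a [^]\<^bsub>G\<^esub> n = \<one>\<^bsub>G\<^esub> \<and>
     b [^]\<^bsub>G\<^esub> (2::nat) = \<one>\<^bsub>G\<^esub> \<and>
     b \<otimes>\<^bsub>G\<^esub> a \<otimes>\<^bsub>G\<^esub> b = inv\<^bsub>G\<^esub> a \<and>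
     Coset.order G = 2 * n"

(* G carries the discrete topology, so it acts continuously iff each element acts continuously. *)
definition G_space :: "('g, 'm) monoid_scheme \<Rightarrow> 'x topology \<Rightarrow> ('g \<Rightarrow> 'x \<Rightarrow> 'x) \<Rightarrow> bool" where
  "G_space G X \<phi> \<longleftrightarrow>
     group_action G (topspace X) \<phi> \<and> (\<forall>g\<in>carrier G. continuous_map X X (\<phi> g))"

definition fixed_points :: "('g, 'm) monoid_scheme \<Rightarrow> 'x topology \<Rightarrow> ('g \<Rightarrow> 'x \<Rightarrow> 'x) \<Rightarrow> 'x set" where
  "fixed_points G X \<phi> = {x \<in> topspace X. \<forall>g\<in>carrier G. \<phi> g x = x}"

definition pseudofree :: "('g, 'm) monoid_scheme \<Rightarrow> 'x topology \<Rightarrow> ('g \<Rightarrow> 'x \<Rightarrow> 'x) \<Rightarrow> bool" where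
  "pseudofree G X \<phi> \<longleftrightarrow>
     (let S = {x \<in> topspace X. stabilizer G \<phi> x \<noteq> {\<one>\<^bsub>G\<^esub>}}
      in subtopology X S = discrete_topology S)"

definition trivial_on_homology ::
    "('g, 'm) monoid_scheme \<Rightarrow> 'x topology \<Rightarrow> ('g \<Rightarrow> 'x \<Rightarrow> 'x) \<Rightarrow> bool" where
  "trivial_on_homology G X \<phi> \<longleftrightarrow>
     (\<forall>g\<in>carrier G. \<forall>i::int. \<forall>c\<in>carrier (homology_group i X).
        hom_induced i X {} X {} (\<phi> g) c = c)"

(* For n = 0 the sums are empty: the disk is a point and its boundary sphere is empty. *)
definition unit_disk :: "nat \<Rightarrow> (nat \<Rightarrow> real) topology" where
  "unit_disk n = subtopology (Euclidean_space n) {v. (\<Sum>i<n. v i ^ 2) \<le> 1}"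

definition boundary_sphere :: "nat \<Rightarrow> (nat \<Rightarrow> real) set" where
  "boundary_sphere n = {v \<in> topspace (unit_disk n). (\<Sum>i<n. v i ^ 2) = 1}"

definition equivariant_cells ::
    "('g, 'm) monoid_scheme \<Rightarrow> nat \<Rightarrow> nat \<Rightarrow> (nat \<Rightarrow> 'g set) \<Rightarrow>
       (nat \<times> 'g set \<times> (nat \<Rightarrow> real)) topology" where
  "equivariant_cells G n m H =
     sum_topology
       (\<lambda>j. prod_topology (discrete_topology (lcosets\<^bsub>G\<^esub> (H j))) (unit_disk n)) {..<m}"

(* The subspace B of X is the pushout of
     A <-- coproduct_j G/H_j x S^{n-1} --> coproduct_j G/H_j x D^n
   for finitely many subgroups H_0, ..., H_{m-1}, with characteristic G-map \<Phi>.  The bijection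
   describes the underlying set of the pushout and the last clause its topology, which is the
   final one with respect to the inclusion of A and \<Phi>. *)
definition attach_equivariant_cells ::
    "('g, 'm) monoid_scheme \<Rightarrow> 'x topology \<Rightarrow> ('g \<Rightarrow> 'x \<Rightarrow> 'x) \<Rightarrow> nat \<Rightarrow> 'x set \<Rightarrow> 'x set \<Rightarrow> bool" where
  "attach_equivariant_cells G X \<phi> n A B \<longleftrightarrow>
     A \<subseteq> B \<and> B \<subseteq> topspace X \<and>
     (\<exists>m H \<Phi>.
        (\<forall>j<m. subgroup (H j) G) \<and>
        continuous_map (equivariant_cells G n m H) (subtopology X B) \<Phi> \<and>
        (\<forall>(j, C, v) \<in> topspace (equivariant_cells G n m H). \<forall>g\<in>carrier G.
           \<Phi> (j, g <#\<^bsub>G\<^esub> C, v) = \<phi> g (\<Phi> (j, C, v))) \<and>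
        (\<forall>(j, C, v) \<in> topspace (equivariant_cells G n m H).
           v \<in> boundary_sphere n \<longrightarrow> \<Phi> (j, C, v) \<in> A) \<and>
        bij_betw \<Phi>
          {(j, C, v). (j, C, v) \<in> topspace (equivariant_cells G n m H) \<and> v \<notin> boundary_sphere n}
          (B - A) \<and>
        (\<forall>U\<subseteq>B. openin (subtopology X B) U \<longleftrightarrow>
           openin (subtopology X A) (U \<inter> A) \<and>
           openin (equivariant_cells G n m H)
             {z \<in> topspace (equivariant_cells G n m H). \<Phi> z \<in> U}))"

(* sk n stands for the (n-1)-skeleton, so that sk 0 is empty. *)
definition finite_G_CW_complex ::
    "('g, 'm) monoid_scheme \<Rightarrow> 'x topology \<Rightarrow> ('g \<Rightarrow> 'x \<Rightarrow> 'x) \<Rightarrow> bool" where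
  "finite_G_CW_complex G X \<phi> \<longleftrightarrow>
     G_space G X \<phi> \<and>
     (\<exists>N sk. sk 0 = {} \<and> sk N = topspace X \<and>
        (\<forall>n<N. attach_equivariant_cells G X \<phi> n (sk n) (sk (Suc n))))"

end

(* Let T = a - 1 and N = 1 + a + ... + a^(p-1) act on the singular chains of X, so that TN = NT = 0.
   A Tate sequence consists of chains c_m, c_(m+1), ... in consecutive degrees such that d c_(n+1) is
   alternately T c_n and N c_n.

   If a has a fixed point x, then y = bx is another one.  Start with a path c_1 from x to y.  The
   vanishing homology of X gives c_2, ..., c_2k with d c_2 = T c_1, d c_3 = N c_2, and so on.  The
   reversed path - b c_1 is continued by the translates of the c_n under b and ab with signs, which
   for even k end in - ab c_2k.  Comparing both continuations, twice the class of N c_2k in H_2k(X)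
   is divisible by p.  Hence c_2k can be changed by a cycle so that N c_2k bounds, and the sequence
   goes on forever.  If a has no fixed point, start instead with a point c_0 and d c_1 = T c_0.
   Now p T c_2k bounds, so T c_2k bounds because H_2k(X) is torsion free.

   On the other hand, X is finite dimensional and free away from the fixed points.  The cell
   structure gives an equivariant map from X to a join of finite sets, one for each dimension of
   cells.  After barycentric subdivision its simplicial approximation sends the Tate sequence to
   chains that vanish in high degrees and are free over Z[Z/p] away from fixed vertices.  Going down from
   the top, c_1 = d e + N e' in the first case and c_0 = d e + N e' in the second.  The coefficient
   of x in d c_1 (which is -1), respectively the augmentation of c_0 (which is 1), would be divisible
   by p. *)
theory Submission
  imports Defs
begin

section \<open>Tate sequences in complexes with a cyclic action\<close>

text \<open>Evenness of k is essential: for k = 1 the dihedral group acts on the 2-sphere by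
  rotations with all the other properties. It enters through a sign of period four. The transported
  sequence ends in - ab c_2k, so with y = N c_2k the comparison produces - by - y, which is
  homologous to -2y; with the opposite sign the two terms would cancel in homology and nothing would
  follow. That p is odd serves to divide by 2. Degree 2k is the only positive degree with homology,
  hence the only place where a Tate sequence can get stuck. Of the map to the join only the dominant
  coordinate is kept: each point is labelled by the centre of a cell. Labels are thus points of X,
  and a fixed label is a fixed point of the action; this carries the hypotheses on fixed points over
  to the combinatorial side. The labelling is not continuous and respects boundaries only on fine
  chains. Therefore the sequence is transported in finite stretches, with one number of subdivisions
  for all chains of the stretch.\<close>

text \<open>The index of \<open>d n\<close> is the degree of its values: it maps \<open>S (Suc n)\<close> to \<open>S n\<close>.\<close>

locale cyclic_complex =
  fixes S :: "nat \<Rightarrow> 'c::ab_group_add set" and d A :: "nat \<Rightarrow> 'c \<Rightarrow> 'c" and p :: nat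
  assumes zero_S [simp]: "0 \<in> S n"
    and diff_S: "x \<in> S n \<Longrightarrow> y \<in> S n \<Longrightarrow> x - y \<in> S n"
    and d_diff: "d n (x - y) = d n x - d n y"
    and A_diff: "A n (x - y) = A n x - A n y"
    and d_S: "x \<in> S (Suc n) \<Longrightarrow> d n x \<in> S n"
    and d_d: "x \<in> S (Suc (Suc n)) \<Longrightarrow> d n (d (Suc n) x) = 0"
    and A_S: "x \<in> S n \<Longrightarrow> A n x \<in> S n"
    and d_A: "x \<in> S (Suc n) \<Longrightarrow> d n (A (Suc n) x) = A n (d n x)"
    and A_pow: "x \<in> S n \<Longrightarrow> (A n ^^ p) x = x"
begin

definition norm :: "nat \<Rightarrow> 'c \<Rightarrow> 'c" where
  "norm n x = (\<Sum>i<p. (A n ^^ i) x)"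

definition tate :: "bool \<Rightarrow> nat \<Rightarrow> 'c \<Rightarrow> 'c" where
  "tate t n x = (if t then A n x - x else norm n x)"

text \<open>The parity \<open>s\<close> decides whether \<open>a - 1\<close> is used in odd degrees (\<open>s = 0\<close>) or in even degrees
  (\<open>s = 1\<close>).\<close>

definition tate_seq :: "nat \<Rightarrow> nat \<Rightarrow> nat \<Rightarrow> (nat \<Rightarrow> 'c) \<Rightarrow> bool" where
  "tate_seq s m M c \<longleftrightarrow>
     (\<forall>n. m \<le> n \<and> n \<le> M \<longrightarrow> c n \<in> S n) \<and>
     (\<forall>n. m \<le> n \<and> n < M \<longrightarrow> tate (odd (n + s)) n (c n) = d n (c (Suc n)))"

text \<open>Exactness in degree \<open>Suc n\<close>; degree 0 is never needed.\<close>

definition exact_at :: "nat \<Rightarrow> bool" where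
  "exact_at n \<longleftrightarrow> (\<forall>x\<in>S (Suc n). d n x = 0 \<longrightarrow> x \<in> d (Suc n) ` S (Suc (Suc n)))"

lemma minus_S: "x \<in> S n \<Longrightarrow> - x \<in> S n"
  using diff_S[of 0 n x] by simp

lemma add_S: "x \<in> S n \<Longrightarrow> y \<in> S n \<Longrightarrow> x + y \<in> S n"
  using diff_S[of x n "- y"] minus_S by simp

lemma sum_S: "(\<And>i. i \<in> I \<Longrightarrow> f i \<in> S n) \<Longrightarrow> sum f I \<in> S n"
  by (induction I rule: infinite_finite_induct) (auto intro: add_S)

lemma d_0 [simp]: "d n 0 = 0"
  using d_diff[of n 0 0] by simp

lemma d_minus: "d n (- x) = - d n x"
  using d_diff[of n 0 x] by simp

lemma d_add: "d n (x + y) = d n x + d n y"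
  using d_diff[of n x "- y"] by (simp add: d_minus)

lemma d_sum: "d n (sum f I) = (\<Sum>i\<in>I. d n (f i))"
  by (induction I rule: infinite_finite_induct) (auto simp: d_add)

lemma A_0 [simp]: "A n 0 = 0"
  using A_diff[of n 0 0] by simp

lemma A_minus: "A n (- x) = - A n x"
  using A_diff[of n 0 x] by simp

lemma A_add: "A n (x + y) = A n x + A n y"
  using A_diff[of n x "- y"] by (simp add: A_minus)

lemma A_sum: "A n (sum f I) = (\<Sum>i\<in>I. A n (f i))"
  by (induction I rule: infinite_finite_induct) (auto simp: A_add)

lemma A_pow_diff: "(A n ^^ i) (x - y) = (A n ^^ i) x - (A n ^^ i) y"
  by (induction i) (auto simp: A_diff)

lemma A_pow_S: "x \<in> S n \<Longrightarrow> (A n ^^ i) x \<in> S n"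
  by (induction i) (auto simp: A_S)

lemma d_A_pow: "x \<in> S (Suc n) \<Longrightarrow> d n ((A (Suc n) ^^ i) x) = (A n ^^ i) (d n x)"
  by (induction i) (auto simp: d_A A_pow_S)

lemma norm_diff: "norm n (x - y) = norm n x - norm n y"
  by (simp add: norm_def A_pow_diff sum_subtractf)

lemma norm_minus: "norm n (- x) = - norm n x"
  using norm_diff[of n x x] norm_diff[of n "x - x" x] by simp

lemma norm_A: "x \<in> S n \<Longrightarrow> norm n (A n x) = norm n x"
proof -
  assume x: "x \<in> S n"
  have "norm n (A n x) = (\<Sum>i<p. (A n ^^ Suc i) x)"
    by (simp add: norm_def funpow_swap1)
  also have "\<dots> - norm n x = (A n ^^ p) x - (A n ^^ 0) x"
    unfolding norm_def sum_subtractf[symmetric] by (rule sum_lessThan_telescope)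
  finally show ?thesis
    using A_pow[OF x] by simp
qed

lemma A_norm: "x \<in> S n \<Longrightarrow> A n (norm n x) = norm n x"
  using norm_A[of x n] by (simp add: norm_def A_sum funpow_swap1)

lemma tate_diff: "tate t n (x - y) = tate t n x - tate t n y"
  by (simp add: tate_def norm_diff A_diff)

lemma tate_0 [simp]: "tate t n 0 = 0"
  using tate_diff[of t n 0 0] by simp

lemma tate_minus: "tate t n (- x) = - tate t n x"
  using tate_diff[of t n 0 x] by simp

lemma tate_add: "tate t n (x + y) = tate t n x + tate t n y"
  using tate_diff[of t n x "- y"] by (simp add: tate_minus)

lemma tate_S: "x \<in> S n \<Longrightarrow> tate t n x \<in> S n"
  by (auto simp: tate_def norm_def intro!: diff_S A_S sum_S A_pow_S)

lemma d_tate: "x \<in> S (Suc n) \<Longrightarrow> d n (tate t (Suc n) x) = tate t n (d n x)"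
  by (simp add: tate_def norm_def d_diff d_A d_sum d_A_pow)

lemma tate_tate: "x \<in> S n \<Longrightarrow> tate (\<not> t) n (tate t n x) = 0"
  by (cases t) (simp_all add: tate_def norm_diff norm_A A_norm)

lemma tate_tate': "x \<in> S n \<Longrightarrow> tate t n (tate (\<not> t) n x) = 0"
  using tate_tate[of x n "\<not> t"] by simp

lemma exact_atD:
  "exact_at n \<Longrightarrow> x \<in> S (Suc n) \<Longrightarrow> d n x = 0 \<Longrightarrow> \<exists>y\<in>S (Suc (Suc n)). d (Suc n) y = x"
  unfolding exact_at_def by blast

text \<open>The member \<open>y\<close> is supplied from outside because degree \<open>M\<close> may
  carry homology. Beyond it, TN = NT = 0 makes the left-hand side of the next relation a cycle, and
  exactness provides the next member.\<close>

lemma tate_seq_extend: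
  assumes c: "tate_seq s m M c" and "m \<le> M"
    and y: "y \<in> S (Suc M)" "tate (odd (M + s)) M (c M) = d M y"
    and ex: "\<And>n. M \<le> n \<Longrightarrow> Suc n < R \<Longrightarrow> exact_at n" and "M < R"
  shows "\<exists>c'. (\<forall>n\<le>M. c' n = c n) \<and> tate_seq s m R c'"
  using Suc_leI[OF \<open>M < R\<close>] ex
proof (induction R rule: dec_induct)
  case base
  show ?case
    using c y \<open>m \<le> M\<close>
    by (intro exI[of _ "c(Suc M := y)"]) (auto simp: tate_seq_def less_Suc_eq le_Suc_eq)
next
  case (step R)
  then obtain c' where eq: "\<forall>n\<le>M. c' n = c n" and c': "tate_seq s m R c'"
    by auto
  obtain r where r: "R = Suc r" "M \<le> r"
    using step by (cases R) auto
  let ?x = "tate (odd (R + s)) R (c' R)"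
  have S: "c' r \<in> S r" "c' R \<in> S R" and rel: "tate (odd (r + s)) r (c' r) = d r (c' R)"
    using c' r \<open>m \<le> M\<close> by (auto simp: tate_seq_def)
  have "d r ?x = tate (odd (R + s)) r (tate (odd (r + s)) r (c' r))"
    using S r rel by (simp add: d_tate)
  also have "\<dots> = 0"
    using tate_tate[OF S(1), of "odd (r + s)"] r by simp
  finally have "d r ?x = 0" .
  moreover have "exact_at r"
    using step.prems r by auto
  moreover have "?x \<in> S (Suc r)"
    using S r by (simp add: tate_S)
  ultimately obtain z where z: "z \<in> S (Suc R)" "d R z = ?x"
    unfolding r(1) using exact_atD by blast
  show ?case
    using eq c' z r \<open>m \<le> M\<close>
    by (intro exI[of _ "c'(Suc R := z)"]) (auto simp: tate_seq_def less_Suc_eq le_Suc_eq)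
qed

text \<open>Comparison of two lifts, degree by degree. Exactness is available only up to degree
  \<open>M\<close>, so in degree \<open>Suc M\<close> the difference is a cycle after correction by
  \<open>w\<close>. The operator in front of \<open>w\<close> is that of degree \<open>M\<close>,
  hence it is killed by the one of degree \<open>Suc M\<close>.\<close>

lemma tate_seq_compare:
  assumes "tate_seq s m (Suc M) c" "tate_seq s m (Suc M) c'" and "m \<le> M"
    and "u \<in> S (Suc m)" "c' m - c m = d m u"
    and "\<And>n. m \<le> n \<Longrightarrow> n < M \<Longrightarrow> exact_at n"
  shows "\<exists>w\<in>S (Suc M). d M (c' (Suc M) - c (Suc M) - tate (odd (M + s)) (Suc M) w) = 0"
  using \<open>m \<le> M\<close> assms(1,2,6)
proof (induction M rule: dec_induct)
  case base
  have "d m (c' (Suc m) - c (Suc m)) = tate (odd (m + s)) m (c' m - c m)"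
    using base by (simp add: tate_seq_def d_diff tate_diff)
  also have "\<dots> = d m (tate (odd (m + s)) (Suc m) u)"
    using assms(4,5) by (simp add: d_tate)
  finally have "d m (c' (Suc m) - c (Suc m) - tate (odd (m + s)) (Suc m) u) = 0"
    by (simp only: d_diff diff_self)
  then show ?case
    using assms(4) by blast
next
  case (step M)
  have sub: "tate_seq s m (Suc M) c" "tate_seq s m (Suc M) c'"
    using step.prems by (auto simp: tate_seq_def)
  have "exact_at n" if "m \<le> n" "n < M" for n
    using step.prems(3)[of n] that by simp
  from step.IH[OF sub this] obtain w where w: "w \<in> S (Suc M)"
    and dw: "d M (c' (Suc M) - c (Suc M) - tate (odd (M + s)) (Suc M) w) = 0"
    by blast
  let ?t = "odd (Suc M + s)"
  have S: "c (Suc M) \<in> S (Suc M)" "c' (Suc M) \<in> S (Suc M)"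
    using sub step.hyps by (auto simp: tate_seq_def)
  then have "c' (Suc M) - c (Suc M) - tate (odd (M + s)) (Suc M) w \<in> S (Suc M)"
    using w by (simp add: diff_S tate_S)
  then obtain v where v: "v \<in> S (Suc (Suc M))"
    and dv: "d (Suc M) v = c' (Suc M) - c (Suc M) - tate (odd (M + s)) (Suc M) w"
    using exact_atD[OF step.prems(3)[of M] _ dw] step.hyps by blast
  have "tate ?t (Suc M) (c (Suc M)) = d (Suc M) (c (Suc (Suc M)))"
    "tate ?t (Suc M) (c' (Suc M)) = d (Suc M) (c' (Suc (Suc M)))"
    using step.prems(1,2) step.hyps unfolding tate_seq_def by (meson le_SucI lessI)+
  then have "d (Suc M) (c' (Suc (Suc M)) - c (Suc (Suc M))) = tate ?t (Suc M) (c' (Suc M) - c (Suc M))"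
    by (simp only: d_diff tate_diff)
  also have "c' (Suc M) - c (Suc M) = d (Suc M) v + tate (\<not> ?t) (Suc M) w"
    unfolding dv by simp
  also have "tate ?t (Suc M) \<dots> = d (Suc M) (tate ?t (Suc (Suc M)) v)"
    by (simp only: tate_add d_tate[OF v] tate_tate'[OF w] add_0_right)
  finally have "d (Suc M) (c' (Suc (Suc M)) - c (Suc (Suc M)) - tate ?t (Suc (Suc M)) v) = 0"
    by (simp only: d_diff diff_self)
  then show ?case
    using v by blast
qed

text \<open>A chase downwards from the zero chain in degree \<open>R\<close>. Inserting the
  representation of \<open>c (Suc n)\<close> into the relation of degree \<open>n\<close> leaves
  \<open>c n - d n e'\<close> in the kernel of T or N, which is the image of the other
  operator.\<close>

lemma tate_seq_descend:
  assumes "tate_seq s m R c" "m \<le> R" and "S R = {0}"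
    and ex: "\<And>n t x. m \<le> n \<Longrightarrow> x \<in> S n \<Longrightarrow> tate t n x = 0 \<Longrightarrow> x \<in> tate (\<not> t) n ` S n"
  shows "\<exists>e\<in>S (Suc m). \<exists>e'\<in>S m. c m = d m e + tate (even (m + s)) m e'"
proof -
  have "\<exists>e\<in>S (Suc n). \<exists>e'\<in>S n. c n = d n e + tate (even (n + s)) n e'"
    if "m \<le> n" "n \<le> R" for n
    using that(2,1)
  proof (induction n rule: inc_induct)
    case base
    have "c R = 0"
      using assms by (auto simp: tate_seq_def)
    then show ?case
      by (intro bexI[of _ 0]) auto
  next
    case (step n)
    then obtain e e' where e: "e \<in> S (Suc (Suc n))" "e' \<in> S (Suc n)"
      and eq: "c (Suc n) = d (Suc n) e + tate (odd (n + s)) (Suc n) e'"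
      by auto
    have cn: "c n \<in> S n"
      using assms(1) step by (auto simp: tate_seq_def)
    have "tate (odd (n + s)) n (c n) = d n (c (Suc n))"
      using assms(1) step by (auto simp: tate_seq_def)
    also have "\<dots> = tate (odd (n + s)) n (d n e')"
      unfolding eq using e by (simp add: d_add d_d d_tate)
    finally have "tate (odd (n + s)) n (c n - d n e') = 0"
      by (simp add: tate_diff)
    moreover have "c n - d n e' \<in> S n"
      using cn e(2) by (intro diff_S d_S)
    ultimately have "c n - d n e' \<in> tate (\<not> odd (n + s)) n ` S n"
      using ex step by blast
    then obtain f where "f \<in> S n" "c n - d n e' = tate (even (n + s)) n f"
      by auto
    then have "c n = d n e' + tate (even (n + s)) n f"
      by (simp add: algebra_simps)
    then show ?case
      using e(2) \<open>f \<in> S n\<close> by blast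
  qed
  then show ?thesis
    using assms(2) by auto
qed

lemma zero_boundary: "0 \<in> d n ` S (Suc n)"
  by (metis d_0 imageI zero_S)

lemma boundary_diff:
  assumes "x \<in> d n ` S (Suc n)" "y \<in> d n ` S (Suc n)"
  shows "x - y \<in> d n ` S (Suc n)"
proof -
  obtain x' y' where "x' \<in> S (Suc n)" "y' \<in> S (Suc n)" "x = d n x'" "y = d n y'"
    using assms by blast
  then show ?thesis
    using d_diff[of n x' y'] diff_S[of x' "Suc n" y'] by (metis imageI)
qed

lemma boundary_minus: "x \<in> d n ` S (Suc n) \<Longrightarrow> - x \<in> d n ` S (Suc n)"
  using boundary_diff[OF zero_boundary, of x] by simp

lemma boundary_add:
  assumes "x \<in> d n ` S (Suc n)" "y \<in> d n ` S (Suc n)"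
  shows "x + y \<in> d n ` S (Suc n)"
  using boundary_diff[OF assms(1) boundary_minus[OF assms(2)]] by simp

lemma boundary_sum:
  "(\<And>i. i \<in> I \<Longrightarrow> f i \<in> d n ` S (Suc n)) \<Longrightarrow> sum f I \<in> d n ` S (Suc n)"
  by (induction I rule: infinite_finite_induct) (auto intro: boundary_add zero_boundary)

end

section \<open>Passing the one degree \<open>K\<close> with homology\<close>

locale cyclic_complex_trivial = cyclic_complex +
  fixes K :: nat
  assumes exact: "Suc n \<noteq> K \<Longrightarrow> exact_at n"
    and A_trivial: "x \<in> S (Suc n) \<Longrightarrow> d n x = 0 \<Longrightarrow> A (Suc n) x - x \<in> d (Suc n) ` S (Suc (Suc n))"
begin

text \<open>Every translate of a cycle is homologous to it, so N acts on homology as multiplication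
  by \<open>p\<close>. The multiple is written as a constant sum since the chains form just an
  abelian group.\<close>

lemma norm_homologous_mult:
  assumes "x \<in> S (Suc n)" "d n x = 0"
  shows "norm (Suc n) x - (\<Sum>i<p. x) \<in> d (Suc n) ` S (Suc (Suc n))"
proof -
  have "(A (Suc n) ^^ i) x - x \<in> d (Suc n) ` S (Suc (Suc n))" for i
  proof (induction i)
    case 0
    show ?case by (simp add: zero_boundary)
  next
    case (Suc i)
    have "d n ((A (Suc n) ^^ i) x) = (A n ^^ i) 0"
      using assms by (simp add: d_A_pow)
    also have "\<dots> = 0"
      by (induction i) auto
    finally have "A (Suc n) ((A (Suc n) ^^ i) x) - (A (Suc n) ^^ i) x \<in> d (Suc n) ` S (Suc (Suc n))"
      using A_trivial assms A_pow_S by blast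
    from boundary_add[OF this Suc] show ?case by simp
  qed
  then show ?thesis
    unfolding norm_def sum_subtractf[symmetric] by (intro boundary_sum) auto
qed

lemma tate_seq_from_0:
  assumes x: "x \<in> S 0" "A 0 x - x \<in> d 0 ` S (Suc 0)"
    and K: "even K" "K > 0"
    and torsion_free: "\<And>n x. Suc n = K \<Longrightarrow> x \<in> S K \<Longrightarrow> d n x = 0 \<Longrightarrow>
      (\<Sum>i<p. x) \<in> d K ` S (Suc K) \<Longrightarrow> x \<in> d K ` S (Suc K)"
  shows "\<exists>c. c 0 = x \<and> tate_seq 1 0 R c"
proof -
  obtain y where y: "y \<in> S (Suc 0)" "tate True 0 x = d 0 y"
    using x by (auto simp: tate_def)
  have "tate_seq 1 0 0 (\<lambda>_. x)"
    using x by (auto simp: tate_seq_def)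
  then have "\<exists>c. (\<forall>n\<le>0. c n = x) \<and> tate_seq 1 0 K c"
  proof (rule tate_seq_extend[OF _ _ y(1)])
    show "tate (odd (0 + 1)) 0 x = d 0 y"
      using y(2) by simp
  qed (use K exact in auto)
  then obtain c where c: "c 0 = x" "tate_seq 1 0 K c"
    by blast
  obtain j where j: "Suc j = K"
    using K by (metis gr0_implies_Suc)
  have S: "c j \<in> S j" "c K \<in> S K"
    using c(2) j by (auto simp: tate_seq_def)
  have "tate (odd (j + 1)) j (c j) = d j (c (Suc j))"
    using c(2) j unfolding tate_seq_def by auto
  then have rel: "norm j (c j) = d j (c K)"
    using K j by (auto simp: tate_def)
  have e: "tate True K (c K) \<in> S K"
    using S by (simp add: tate_S)
  have "d j (tate True K (c K)) = tate True j (norm j (c j))"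
    using d_tate[of "c K" j True] S rel unfolding j by simp
  also have "\<dots> = 0"
    using tate_tate'[OF S(1), of True] by (simp add: tate_def)
  finally have de: "d j (tate True K (c K)) = 0" .
  \<comment> \<open>NT = 0, whereas N acts as \<open>p\<close> on homology; hence \<open>p\<close>
    times the cycle T c_K bounds.\<close>
  have "norm K (tate True K (c K)) = 0"
    using tate_tate[OF S(2), of True] by (simp add: tate_def)
  with norm_homologous_mult[of "tate True K (c K)" j] de e
  have "- (\<Sum>i<p. tate True K (c K)) \<in> d K ` S (Suc K)"
    unfolding j by simp
  then have "(\<Sum>i<p. tate True K (c K)) \<in> d K ` S (Suc K)"
    using boundary_minus[of "- (\<Sum>i<p. tate True K (c K))"] by simp
  from torsion_free[OF j e de this]
  obtain z where z: "z \<in> S (Suc K)" "tate True K (c K) = d K z"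
    by blast
  \<comment> \<open>The extension has to go beyond \<open>K\<close> whatever \<open>R\<close> is,
    and is cut down to \<open>R\<close> afterwards. As \<open>K\<close> is even and the parity is 1,
    the operator of degree \<open>K\<close> is T, as \<open>z\<close> requires.\<close>
  have "\<exists>c'. (\<forall>n\<le>K. c' n = c n) \<and> tate_seq 1 0 (max R (Suc K)) c'"
  proof (rule tate_seq_extend[OF c(2) _ z(1)])
    show "tate (odd (K + 1)) K (c K) = d K z"
      using z(2) K by simp
  qed (use K exact in auto)
  then obtain c' where "\<forall>n\<le>K. c' n = c n" "tate_seq 1 0 (max R (Suc K)) c'"
    by blast
  then have "c' 0 = x \<and> tate_seq 1 0 R c'"
    using c(1) unfolding tate_seq_def by (auto simp del: even_Suc even_add odd_add)
  then show ?thesis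
    by blast
qed

end

section \<open>Complexes with an action of the dihedral group\<close>

locale dihedral_complex = cyclic_complex_trivial +
  fixes B :: "nat \<Rightarrow> 'a \<Rightarrow> 'a"
  assumes B_diff: "B n (x - y) = B n x - B n y"
    and B_S: "x \<in> S n \<Longrightarrow> B n x \<in> S n"
    and d_B: "x \<in> S (Suc n) \<Longrightarrow> d n (B (Suc n) x) = B n (d n x)"
    and B_trivial: "x \<in> S (Suc n) \<Longrightarrow> d n x = 0 \<Longrightarrow> B (Suc n) x - x \<in> d (Suc n) ` S (Suc (Suc n))"
    and ABA: "x \<in> S n \<Longrightarrow> A n (B n (A n x)) = B n x"
begin

lemma B_0 [simp]: "B n 0 = 0"
  using B_diff[of n 0 0] by simp

lemma B_minus: "B n (- x) = - B n x"
  using B_diff[of n 0 x] by simp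

lemma B_add: "B n (x + y) = B n x + B n y"
  using B_diff[of n x "- y"] by (simp add: B_minus)

lemma B_sum: "B n (sum f I) = (\<Sum>i\<in>I. B n (f i))"
  by (induction I rule: infinite_finite_induct) (auto simp: B_add)

text \<open>Iterating \<open>ABA\<close> gives a^i b a^i = b, and applying a^(p-i) removes the left
  factor.\<close>

lemma B_A_pow:
  assumes "x \<in> S n" "i \<le> p"
  shows "B n ((A n ^^ i) x) = (A n ^^ (p - i)) (B n x)"
proof -
  have *: "(A n ^^ i) (B n ((A n ^^ i) x)) = B n x" for i
  proof (induction i)
    case (Suc i)
    have "(A n ^^ Suc i) (B n ((A n ^^ Suc i) x)) = (A n ^^ i) (A n (B n (A n ((A n ^^ i) x))))"
      by (simp add: funpow_swap1)
    then show ?case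
      using Suc by (simp add: ABA A_pow_S assms)
  qed simp
  have "(A n ^^ (p - i)) (B n x) = (A n ^^ (p - i + i)) (B n ((A n ^^ i) x))"
    unfolding funpow_add o_apply * ..
  then show ?thesis
    using assms by (simp add: A_pow A_pow_S B_S)
qed

lemma B_norm:
  assumes "x \<in> S n"
  shows "B n (norm n x) = norm n (B n x)"
proof -
  have "B n (norm n x) = (\<Sum>i<p. (A n ^^ (p - i)) (B n x))"
    by (simp add: norm_def B_sum B_A_pow assms)
  also have "\<dots> = (\<Sum>i<p. (A n ^^ Suc i) (B n x))"
    by (subst sum.nat_diff_reindex[symmetric]) (auto intro!: sum.cong simp: Suc_diff_Suc)
  also have "\<dots> = norm n (A n (B n x))"
    by (simp add: norm_def funpow_swap1)
  finally show ?thesis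
    by (simp add: norm_A B_S assms)
qed

text \<open>From \<open>(a - 1) b = - a b (a - 1)\<close> and \<open>N b = b N\<close>, moving \<open>b\<close> along a Tate sequence alternates between
  \<open>b\<close> and \<open>a b\<close> and changes sign at every second step.\<close>

definition twist :: "nat \<Rightarrow> 'a \<Rightarrow> 'a" where
  "twist n x =
     (let y = if even n then A n (B n x) else B n x in if n mod 4 \<in> {2, 3} then y else - y)"

lemma twist_S: "x \<in> S n \<Longrightarrow> twist n x \<in> S n"
  by (auto simp: twist_def Let_def intro: A_S B_S minus_S)

lemma tate_twist:
  assumes x: "x \<in> S n" and y: "y \<in> S (Suc n)" and eq: "tate (odd n) n x = d n y"
  shows "tate (odd n) n (twist n x) = d n (twist (Suc n) y)"
proof -
  have N: "norm n (A n (B n x)) = B n (norm n x)"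
    using x by (simp add: norm_A B_S B_norm)
  have "n mod 4 < 4" by simp
  then consider "n mod 4 = 0" | "n mod 4 = 1" | "n mod 4 = 2" | "n mod 4 = 3" by linarith
  then show ?thesis
  proof cases
    case 1
    then have "even n" by presburger
    with 1 show ?thesis
      using eq N x y by (simp add: twist_def mod_Suc tate_def d_B d_minus norm_minus)
  next
    case 2
    then have "odd n" by presburger
    with 2 show ?thesis
      using eq x y
      by (simp add: twist_def mod_Suc tate_def d_B d_A B_S A_minus A_diff B_diff ABA flip: eq)
  next
    case 3
    then have "even n" by presburger
    with 3 show ?thesis
      using eq N x y by (simp add: twist_def mod_Suc tate_def d_B d_minus)
  next
    case 4
    then have "odd n" by presburger
    with 4 show ?thesis
      using eq x y
      by (simp add: twist_def mod_Suc tate_def d_B d_A B_S A_minus A_diff B_diff ABA d_minus flip: eq)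
  qed
qed

text \<open>The hypotheses describe a path \<open>c1\<close> whose ends are fixed by a and exchanged
  by b. In degree \<open>K\<close> the symmetry under b shows that the obstruction N c_K is the norm
  of a cycle up to a boundary, so that it can be removed.\<close>

lemma tate_seq_from_1:
  assumes c1: "c1 \<in> S 1" "tate True 0 (d 0 c1) = 0" "B 0 (d 0 c1) = - d 0 c1"
    and K: "4 dvd K" "K > 0" and "odd p"
  shows "\<exists>c. d 0 (c 1) = d 0 c1 \<and> tate_seq 0 1 R c"
proof -
  have K4: "K \<ge> 4" using K by (auto elim: dvdE)
  then obtain j where K_j: "K = Suc j" "j \<ge> 3"
    by (cases K) auto
  moreover have "odd j"
    using K(1) unfolding K_j by presburger
  ultimately have j: "K = Suc j" "odd j" "j \<ge> 3"
    by auto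
  have ex0: "exact_at 0"
    using exact[of 0] K4 by simp
  have "d 0 (tate True 1 c1) = 0"
    using c1 by (simp add: d_tate)
  then have "\<exists>y\<in>S (Suc 1). d 1 y = tate True 1 c1"
    using exact_atD[OF ex0, of "tate True 1 c1"] c1 by (simp add: tate_S)
  then obtain y1 where y1: "y1 \<in> S (Suc 1)" "tate True 1 c1 = d 1 y1"
    by metis
  have "tate_seq 0 1 1 (\<lambda>_. c1)"
    using c1 by (auto simp: tate_seq_def)
  then have "\<exists>c. (\<forall>n\<le>1. c n = c1) \<and> tate_seq 0 1 K c"
    by (rule tate_seq_extend[OF _ _ y1(1)]) (use y1 K4 in \<open>auto intro: exact\<close>)
  then obtain c where c: "c 1 = c1" "tate_seq 0 1 K c"
    by auto
  define c' where "c' n = twist n (c n)" for n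
  have c': "tate_seq 0 1 K c'"
    using c(2) unfolding tate_seq_def c'_def by (auto intro!: twist_S tate_twist)
  \<comment> \<open>\<open>twist 1\<close> is -b, and b negates the boundary of \<open>c1\<close>:
    both sequences start with chains of the same boundary, which are homologous since degree 1 is
    exact.\<close>
  have "d 0 (c' 1 - c 1) = 0"
    using c c1 by (simp add: c'_def twist_def d_diff d_minus d_B)
  moreover have "c' 1 - c 1 \<in> S (Suc 0)"
    using c' c(2) K4 by (auto simp: tate_seq_def intro: diff_S)
  ultimately have "\<exists>u\<in>S (Suc 1). d 1 u = c' 1 - c 1"
    using exact_atD[OF ex0, of "c' 1 - c 1"] by simp
  then obtain u where u: "u \<in> S (Suc 1)" "c' 1 - c 1 = d 1 u"
    by metis
  \<comment> \<open>Degrees below \<open>K\<close> are exact, so the two sequences agree in degree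
    \<open>K\<close> up to T w and a cycle, called \<open>z\<close> below.\<close>
  have "\<exists>w\<in>S (Suc j). d j (c' (Suc j) - c (Suc j) - tate (odd (j + 0)) (Suc j) w) = 0"
  proof (rule tate_seq_compare[where m = 1 and c = c and c' = c', OF _ _ _ u])
    show "tate_seq 0 1 (Suc j) c" "tate_seq 0 1 (Suc j) c'"
      using c(2) c' unfolding j(1) .
    show "1 \<le> j"
      using j by simp
    show "exact_at n" if "1 \<le> n" "n < j" for n
      using exact[of n] that unfolding j(1) by simp
  qed
  then have "\<exists>w\<in>S K. d j (c' K - c K - tate True K w) = 0"
    using j(2) unfolding j(1)[symmetric] by simp
  then obtain w where w: "w \<in> S K" and dz: "d j (c' K - c K - tate True K w) = 0"
    by metis
  define z where "z = c' K - c K - tate True K w"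
  define y where "y = norm K (c K)"
  have S: "c j \<in> S j" "c K \<in> S K" "c' K \<in> S K"
    using c(2) c' K4 j by (auto simp: tate_seq_def)
  have "tate (odd (j + 0)) j (c j) = d j (c (Suc j))"
    using c(2) j unfolding tate_seq_def by (metis One_nat_def Suc_leI lessI odd_pos)
  then have rel: "tate True j (c j) = d j (c K)"
    using j by simp
  have z: "z \<in> S K" "d j z = 0"
    using S w dz by (auto simp: z_def intro!: diff_S tate_S)
  have yS: "y \<in> S K"
    using tate_S[OF S(2), of False] by (simp add: y_def tate_def)
  have "d j (tate False K (c K)) = tate False j (tate True j (c j))"
    using S j rel by (simp add: d_tate)
  then have dy: "d j y = 0"
    using tate_tate[OF S(1), of True] by (simp add: y_def tate_def)
  \<comment> \<open>Here 4 dvd K matters: \<open>twist K\<close> is -ab, and N absorbs the a.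
    Because of the sign the two copies of \<open>y\<close> add up in the norm of \<open>z\<close>
    instead of cancelling in homology.\<close>
  have "norm K (c' K) = - B K y"
    using K S by (simp add: c'_def twist_def Let_def y_def B_norm norm_A B_S norm_minus)
  moreover have "norm K (tate True K w) = 0"
    using tate_tate[OF w, of True] by (simp add: tate_def)
  ultimately have Nz: "norm K z = - B K y - y"
    by (simp add: z_def norm_diff y_def)
  let ?Bd = "d K ` S (Suc K)"
  have "B K y - y \<in> ?Bd" "norm K z - (\<Sum>i<p. z) \<in> ?Bd"
    using B_trivial[of y j] norm_homologous_mult[of z j] yS dy z j by auto
  then have "(B K y - y) + (norm K z - (\<Sum>i<p. z)) \<in> ?Bd"
    by (rule boundary_add)
  then have "- ((B K y - y) + (norm K z - (\<Sum>i<p. z))) \<in> ?Bd"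
    by (rule boundary_minus)
  then have 2: "y + y + (\<Sum>i<p. z) \<in> ?Bd"
    by (simp add: Nz algebra_simps)
  obtain q where q: "p = Suc (2 * q)"
    using \<open>odd p\<close> by (auto elim: oddE)
  \<comment> \<open>As \<open>2y + pz\<close> bounds and \<open>p = 2q + 1\<close>, the cycle \<open>y\<close> is homologous to \<open>p (y + qz)\<close>.\<close>
  define v where "v = y + (\<Sum>i<q. z)"
  have v: "v \<in> S K" "d j v = 0"
    using yS z dy by (auto simp: v_def d_add d_sum intro!: add_S sum_S)
  have yy: "(\<Sum>i<2 * q. y) = (\<Sum>i<q. y + y)"
    by (induction q) (auto simp: add.assoc)
  have "(\<Sum>i<p. v) = (\<Sum>i<p. y) + (\<Sum>j<q. \<Sum>i<p. z)"
    unfolding v_def sum.distrib by (subst sum.swap) rule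
  also have "(\<Sum>i<p. y) = (\<Sum>i<q. y + y) + y"
    by (simp add: q yy)
  finally have "(\<Sum>i<p. v) - y = (\<Sum>i<q. y + y + (\<Sum>i<p. z))"
    by (simp add: sum.distrib)
  also have "\<dots> \<in> ?Bd"
    using 2 by (intro boundary_sum)
  finally have "(\<Sum>i<p. v) - y \<in> ?Bd" .
  \<comment> \<open>The norm of \<open>v\<close> is homologous to p v and so to y = N c_K.
    Subtracting \<open>v\<close> from c_K therefore makes its norm a boundary.\<close>
  from boundary_add[OF this norm_homologous_mult[of v j, folded j(1), OF v]]
  have "norm K v - y \<in> ?Bd"
    by simp
  from boundary_minus[OF this] have "- (norm K v - y) \<in> ?Bd" .
  then obtain x where x: "x \<in> S (Suc K)" "tate False K (c K - v) = d K x"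
    by (auto simp: tate_def norm_diff y_def)
  \<comment> \<open>Since \<open>v\<close> is a cycle, the relation between degrees \<open>j\<close>
    and \<open>K\<close> survives this change.\<close>
  define c2 where "c2 = c(K := c K - v)"
  have "tate_seq 0 1 K c2"
    unfolding tate_seq_def
  proof (intro conjI allI impI; elim conjE)
    fix n assume "1 \<le> n" "n \<le> K"
    then show "c2 n \<in> S n"
      using c(2) S v by (auto simp: c2_def tate_seq_def intro: diff_S)
  next
    fix n assume n: "1 \<le> n" "n < K"
    show "tate (odd (n + 0)) n (c2 n) = d n (c2 (Suc n))"
      using c(2) n v j by (auto simp: c2_def tate_seq_def d_diff)
  qed
  then have "\<exists>c'. (\<forall>n\<le>K. c' n = c2 n) \<and> tate_seq 0 1 (max R (Suc K)) c'"
    by (rule tate_seq_extend[OF _ _ x(1)]) (use x K in \<open>auto intro: exact simp: c2_def\<close>)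
  then obtain c3 where c3: "\<forall>n\<le>K. c3 n = c2 n" "tate_seq 0 1 (max R (Suc K)) c3"
    by blast
  then have "c3 1 = c1"
    using c(1) K4 by (auto simp: c2_def)
  moreover have "tate_seq 0 1 R c3"
    using c3(2) unfolding tate_seq_def by (auto simp del: even_Suc even_add odd_add)
  ultimately show ?thesis
    by blast
qed

end

section \<open>Ordered chains on labels\<close>

definition frag_map :: "('k \<Rightarrow> 'l) \<Rightarrow> ('k \<Rightarrow>\<^sub>0 int) \<Rightarrow> ('l \<Rightarrow>\<^sub>0 int)" where
  "frag_map f = frag_extend (frag_of \<circ> f)"

lemma frag_map_of [simp]: "frag_map f (frag_of x) = frag_of (f x)"
  by (simp add: frag_map_def)

lemma frag_map_0 [simp]: "frag_map f 0 = 0"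
  by (simp add: frag_map_def)

lemma frag_map_diff: "frag_map f (a - b) = frag_map f a - frag_map f b"
  by (simp add: frag_map_def frag_extend_diff)

lemma frag_map_sum: "finite I \<Longrightarrow> frag_map f (sum g I) = (\<Sum>i\<in>I. frag_map f (g i))"
  by (simp add: frag_map_def frag_extend_sum o_def)

lemma frag_map_funpow:
  fixes f :: "'k \<Rightarrow> 'k"
  shows "(frag_map f ^^ i) (frag_of x) = frag_of ((f ^^ i) x)"
  by (induction i) auto

lemma frag_map_funpow_diff:
  fixes f :: "'k \<Rightarrow> 'k"
  shows "(frag_map f ^^ i) (a - b) = (frag_map f ^^ i) a - (frag_map f ^^ i) b"
  by (induction i) (auto simp: frag_map_diff)

lemma frag_map_funpow_0 [simp]:
  fixes f :: "'k \<Rightarrow> 'k"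
  shows "(frag_map f ^^ i) 0 = 0"
  by (induction i) auto

lemma keys_frag_map: "Poly_Mapping.keys c \<subseteq> X \<Longrightarrow> f ` X \<subseteq> Y \<Longrightarrow> Poly_Mapping.keys (frag_map f c) \<subseteq> Y"
  unfolding frag_map_def using keys_frag_extend[of "frag_of \<circ> f" c] by fastforce

lemma keys_frag_extend_subset:
  "Poly_Mapping.keys c \<subseteq> X \<Longrightarrow> (\<And>x. x \<in> X \<Longrightarrow> Poly_Mapping.keys (f x) \<subseteq> Y) \<Longrightarrow> Poly_Mapping.keys (frag_extend f c) \<subseteq> Y"
  using keys_frag_extend[of f c] by blast

lemma keys_subset_diff: "Poly_Mapping.keys a \<subseteq> X \<Longrightarrow> Poly_Mapping.keys b \<subseteq> X \<Longrightarrow> Poly_Mapping.keys (a - b) \<subseteq> X"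
  using keys_diff[of a b] by blast

lemma keys_subset_sum: "(\<And>i. i \<in> I \<Longrightarrow> Poly_Mapping.keys (f i) \<subseteq> X) \<Longrightarrow> Poly_Mapping.keys (sum f I) \<subseteq> X"
  using keys_sum[of f I] by blast

section \<open>Contracting the periodic complex of a free cyclic permutation\<close>

locale free_cyclic =
  fixes f :: "'k \<Rightarrow> 'k" and p :: nat and X :: "'k set"
  assumes closed: "x \<in> X \<Longrightarrow> f x \<in> X"
    and period: "x \<in> X \<Longrightarrow> (f ^^ p) x = x"
    and free: "x \<in> X \<Longrightarrow> 0 < i \<Longrightarrow> i < p \<Longrightarrow> (f ^^ i) x \<noteq> x"
    and p_pos: "p > 0"
begin

definition orb :: "'k \<Rightarrow> 'k set" where "orb x = range (\<lambda>i. (f ^^ i) x)"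
text \<open>The choice depends on \<open>x\<close> only through its orbit, so it is the same for all
  points of the orbit.\<close>

definition rep :: "'k \<Rightarrow> 'k" where "rep x = (SOME y. y \<in> orb x)"
definition pos :: "'k \<Rightarrow> nat" where "pos x = (LEAST i. (f ^^ i) (rep x) = x)"

lemma closed_funpow: "x \<in> X \<Longrightarrow> (f ^^ i) x \<in> X"
  by (induction i) (auto simp: closed)

lemma funpow_inj:
  assumes x: "x \<in> X" and "i < p" "j < p" "(f ^^ i) x = (f ^^ j) x"
  shows "i = j"
proof -
  have "\<not> i < j" if "i < p" "j < p" "(f ^^ i) x = (f ^^ j) x" for i j
  proof
    assume "i < j"
    have "x = (f ^^ (p - i + i)) x"
      using that by (simp add: period x)
    also have "\<dots> = (f ^^ (p - i + j)) x"
      by (simp only: funpow_add o_apply that(3))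
    also have "p - i + j = j - i + p"
      using that \<open>i < j\<close> by simp
    also have "(f ^^ \<dots>) x = (f ^^ (j - i)) x"
      by (simp add: funpow_add period x)
    finally show False
      using free[OF x, of "j - i"] that \<open>i < j\<close>
      by (metis less_imp_diff_less zero_less_diff)
  qed
  then show ?thesis
    using assms by (metis nat_neq_iff)
qed

lemma orb_f: "x \<in> X \<Longrightarrow> orb (f x) = orb x"
proof -
  assume x: "x \<in> X"
  have "(f ^^ i) (f x) \<in> orb x" for i
    unfolding orb_def using funpow_swap1[of f i x] by (metis funpow.simps(2) o_apply rangeI)
  moreover have "(f ^^ i) x \<in> orb (f x)" for i
  proof -
    have "(f ^^ i) x = (f ^^ (i + p)) x"
      by (simp add: funpow_add period x)
    also have "i + p = Suc (i + p - 1)"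
      using p_pos by simp
    also have "(f ^^ \<dots>) x = (f ^^ (i + p - 1)) (f x)"
      by (simp only: funpow_Suc_right o_apply)
    finally show ?thesis
      unfolding orb_def by blast
  qed
  ultimately show ?thesis
    unfolding orb_def by blast
qed

lemma rep_f: "x \<in> X \<Longrightarrow> rep (f x) = rep x"
  by (simp add: rep_def orb_f)

lemma rep_funpow: "x \<in> X \<Longrightarrow> rep ((f ^^ i) x) = rep x"
  by (induction i) (auto simp: rep_f closed_funpow)

lemma rep_in_orb: "rep x \<in> orb x"
  unfolding rep_def by (rule someI[of _ x]) (auto simp: orb_def intro: range_eqI[of _ _ 0])

lemma rep_in: "x \<in> X \<Longrightarrow> rep x \<in> X"
  using rep_in_orb[of x] by (auto simp: orb_def closed_funpow)

lemma pos: assumes "x \<in> X" shows "(f ^^ pos x) (rep x) = x" "pos x < p"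
proof -
  obtain i where i: "rep x = (f ^^ i) x"
    using rep_in_orb[of x] by (auto simp: orb_def)
  \<comment> \<open>Going on by (p - 1) i steps undoes i steps, since together they make a multiple
    of the period.\<close>
  have "(f ^^ ((p - 1) * i)) (rep x) = (f ^^ ((p - 1) * i + i)) x"
    by (simp add: i funpow_add)
  also have "(p - 1) * i + i = p * i"
    using p_pos by (cases p) auto
  also have "(f ^^ (p * i)) x = x"
    using funpow_mod_eq[OF period[OF assms], of "p * i"] by simp
  finally have ex: "(f ^^ ((p - 1) * i)) (rep x) = x" .
  then show "(f ^^ pos x) (rep x) = x"
    unfolding pos_def by (rule LeastI)
  have "(f ^^ ((p - 1) * i mod p)) (rep x) = x"
    using funpow_mod_eq[OF period[OF rep_in[OF assms]]] ex by metis
  then have "pos x \<le> (p - 1) * i mod p"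
    unfolding pos_def by (rule Least_le)
  then show "pos x < p"
    using p_pos by (meson le_less_trans mod_less_divisor)
qed

lemma pos_eqI: "x \<in> X \<Longrightarrow> i < p \<Longrightarrow> (f ^^ i) (rep x) = x \<Longrightarrow> pos x = i"
  using funpow_inj[OF rep_in, of x "pos x" i] pos[of x] by simp

text \<open>\<open>contr\<close> and \<open>wrap\<close> are a contracting homotopy of the periodic complex with differentials \<open>f - 1\<close>
  and \<open>1 + f + \<dots> + f\<^sup>p\<^sup>-\<^sup>1\<close>.\<close>

definition contr :: "('k \<Rightarrow>\<^sub>0 int) \<Rightarrow> ('k \<Rightarrow>\<^sub>0 int)" where
  "contr = frag_extend (\<lambda>x. \<Sum>i<pos x. frag_of ((f ^^ i) (rep x)))"

definition wrap :: "('k \<Rightarrow>\<^sub>0 int) \<Rightarrow> ('k \<Rightarrow>\<^sub>0 int)" where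
  "wrap = frag_extend (\<lambda>x. if f x = rep x then frag_of (rep x) else 0)"

lemma contr_diff: "contr (a - b) = contr a - contr b"
  and wrap_diff: "wrap (a - b) = wrap a - wrap b"
  by (simp_all add: contr_def wrap_def frag_extend_diff)

lemma wrap_sum: "wrap (sum g I) = (\<Sum>i\<in>I. wrap (g i))"
  by (induction I rule: infinite_finite_induct) (auto simp: wrap_def frag_extend_add)

lemma keys_contr: "Poly_Mapping.keys c \<subseteq> X \<Longrightarrow> Poly_Mapping.keys (contr c) \<subseteq> X"
  unfolding contr_def
  by (erule keys_frag_extend_subset) (auto intro!: keys_subset_sum closed_funpow rep_in)

lemma keys_wrap: "Poly_Mapping.keys c \<subseteq> X \<Longrightarrow> Poly_Mapping.keys (wrap c) \<subseteq> X"
  unfolding wrap_def by (erule keys_frag_extend_subset) (auto intro!: rep_in)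

text \<open>Let r represent the orbit of \<open>x\<close>. The part with \<open>contr\<close>
  telescopes to x - r. Exactly one of the p translates of \<open>x\<close> is sent to r by
  \<open>f\<close>, so \<open>wrap\<close> of the norm is r.\<close>

lemma homotopy1:
  assumes "Poly_Mapping.keys c \<subseteq> X"
  shows "c = (frag_map f (contr c) - contr c) + wrap (\<Sum>i<p. (frag_map f ^^ i) c)"
  using assms
proof (induction c rule: frag_induction)
  case zero
  show ?case
    by (simp add: contr_def wrap_def)
next
  case (one x)
  have "frag_map f (contr (frag_of x)) - contr (frag_of x) =
      (\<Sum>i<pos x. frag_of ((f ^^ Suc i) (rep x)) - frag_of ((f ^^ i) (rep x)))"
    by (simp add: contr_def frag_map_sum sum_subtractf)
  also have "\<dots> = frag_of x - frag_of (rep x)"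
    by (subst sum_lessThan_telescope) (simp add: pos one)
  finally have 1: "frag_map f (contr (frag_of x)) - contr (frag_of x) = frag_of x - frag_of (rep x)" .
  have iff: "(f ^^ Suc i) x = rep x \<longleftrightarrow> i = p - 1 - pos x" if "i < p" for i
  proof -
    have "(f ^^ Suc (p - 1 - pos x)) x = (f ^^ (Suc (p - 1 - pos x) + pos x)) (rep x)"
      by (simp only: funpow_add o_apply pos one)
    also have "Suc (p - 1 - pos x) + pos x = p"
      using pos(2)[OF one] by simp
    finally have *: "(f ^^ Suc (p - 1 - pos x)) x = rep x"
      by (simp add: period rep_in one)
    show ?thesis
    proof
      assume "(f ^^ Suc i) x = rep x"
      then have "(f ^^ i) (f x) = (f ^^ (p - 1 - pos x)) (f x)"
        using * by (simp only: funpow_Suc_right o_apply)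
      then show "i = p - 1 - pos x"
        using funpow_inj[OF closed[OF one], of i "p - 1 - pos x"] that by simp
    qed (use * in simp)
  qed
  have "wrap (\<Sum>i<p. (frag_map f ^^ i) (frag_of x)) =
      (\<Sum>i<p. if (f ^^ Suc i) x = rep x then frag_of (rep x) else 0)"
    by (simp add: wrap_sum frag_map_funpow) (auto simp: wrap_def rep_funpow one intro!: sum.cong)
  also have "\<dots> = (\<Sum>i<p. if i = p - 1 - pos x then frag_of (rep x) else 0)"
    by (rule sum.cong) (auto simp only: iff lessThan_iff)
  also have "\<dots> = frag_of (rep x)"
    using p_pos by simp
  finally show ?case
    using 1 by simp
next
  case (diff a b)
  have "(frag_map f (contr (a - b)) - contr (a - b)) + wrap (\<Sum>i<p. (frag_map f ^^ i) (a - b)) =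
    ((frag_map f (contr a) - contr a) + wrap (\<Sum>i<p. (frag_map f ^^ i) a)) -
    ((frag_map f (contr b) - contr b) + wrap (\<Sum>i<p. (frag_map f ^^ i) b))"
    by (simp add: contr_diff wrap_diff frag_map_diff frag_map_funpow_diff sum_subtractf)
  then show ?case
    using diff by simp
qed

text \<open>If \<open>f x\<close> is not the representative r, then \<open>contr\<close> of f x - x
  is \<open>x\<close> and \<open>wrap\<close> gives 0. If it is r, then \<open>contr\<close> gives
  minus the sum of all other points of the orbit, and the norm of r leaves \<open>x\<close>.\<close>

lemma homotopy2:
  assumes "Poly_Mapping.keys c \<subseteq> X"
  shows "c = contr (frag_map f c - c) + (\<Sum>i<p. (frag_map f ^^ i) (wrap c))"
  using assms
proof (induction c rule: frag_induction)
  case zero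
  show ?case
    by (simp add: contr_def wrap_def)
next
  case (one x)
  show ?case
  proof (cases "f x = rep x")
    case True
    have "(f ^^ Suc (pos x)) (rep x) = (f ^^ 0) (rep x)"
      using True one by (simp add: pos)
    then have "Suc (pos x) = p"
      using funpow_inj[OF rep_in[OF one], of "Suc (pos x)" 0] pos(2)[OF one] p_pos
      by (metis Suc_lessI nat.distinct(1))
    moreover have "pos (f x) = 0"
      using True one rep_f[OF one] p_pos by (intro pos_eqI closed) auto
    ultimately show ?thesis
      using True pos(1)[OF one]
      by (auto simp: contr_diff wrap_def frag_map_funpow simp flip: \<open>Suc (pos x) = p\<close>) (simp add: contr_def)
  next
    case False
    have "(f ^^ Suc (pos x)) (rep x) = f x"
      using one by (simp add: pos)
    then have "Suc (pos x) \<noteq> p"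
      using False period[OF rep_in[OF one]] by auto
    then have "pos (f x) = Suc (pos x)"
      using one pos[OF one] rep_f[OF one] by (intro pos_eqI closed) auto
    then show ?thesis
      using False pos(1)[OF one] one by (simp add: contr_diff wrap_def) (simp add: contr_def rep_f)
  qed
next
  case (diff a b)
  have "contr (frag_map f (a - b) - (a - b)) + (\<Sum>i<p. (frag_map f ^^ i) (wrap (a - b))) =
    (contr (frag_map f a - a) + (\<Sum>i<p. (frag_map f ^^ i) (wrap a))) -
    (contr (frag_map f b - b) + (\<Sum>i<p. (frag_map f ^^ i) (wrap b)))"
    by (simp add: contr_diff wrap_diff frag_map_diff frag_map_funpow_diff sum_subtractf)
  then show ?case
    using diff by simp
qed

end

text \<open>A translate of a key equals the fixed point \<open>x\<close> only if the key is
  \<open>x\<close>. So each of the p summands has the same coefficient at \<open>x\<close>.\<close>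

lemma dvd_lookup_norm_fixed:
  fixes f :: "'k \<Rightarrow> 'k"
  assumes c: "Poly_Mapping.keys c \<subseteq> X" and "\<And>y. y \<in> X \<Longrightarrow> f y \<in> X \<and> (f ^^ p) y = y" and "f x = x"
  shows "int p dvd poly_mapping.lookup (\<Sum>i<p. (frag_map f ^^ i) c) x"
  using c
proof (induction c rule: frag_induction)
  case zero
  then show ?case
    by simp
next
  case (one y)
  have fixed: "(f ^^ i) x = x" for i
    using \<open>f x = x\<close> by (induction i) auto
  have "(f ^^ i) y = x \<longleftrightarrow> y = x" if "i < p" for i
  proof
    assume "(f ^^ i) y = x"
    then have "(f ^^ (p - i + i)) y = x"
      by (simp only: funpow_add o_apply fixed)
    then show "y = x"
      using assms(2)[OF one] that by simp
  qed (simp add: fixed)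
  then have "poly_mapping.lookup (\<Sum>i<p. (frag_map f ^^ i) (frag_of y)) x = (\<Sum>i<p. if y = x then 1 else 0)"
    unfolding lookup_sum frag_map_funpow by (intro sum.cong) (auto simp: lookup_single when_def)
  then show ?case
    by simp
next
  case (diff a b)
  then show ?case
    by (simp add: frag_map_funpow_diff sum_subtractf lookup_minus)
qed

text \<open>The cone formula for the boundary of an ordered simplex. The empty list is a simplex of
  degree -1: with \<open>list_bd [l] = frag_of []\<close> this is the augmented complex, and a chain
  of degree n consists of lists of length \<open>Suc n\<close>.\<close>

primrec list_bd :: "'l list \<Rightarrow> ('l list \<Rightarrow>\<^sub>0 int)" where
  "list_bd [] = 0"
| "list_bd (l # w) = frag_of w - frag_map ((#) l) (list_bd w)"

definition list_boundary :: "('l list \<Rightarrow>\<^sub>0 int) \<Rightarrow> ('l list \<Rightarrow>\<^sub>0 int)" where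
  "list_boundary = frag_extend list_bd"

lemma list_boundary_of [simp]: "list_boundary (frag_of w) = list_bd w"
  by (simp add: list_boundary_def)

lemma list_boundary_0 [simp]: "list_boundary 0 = 0"
  by (simp add: list_boundary_def)

lemma list_boundary_diff: "list_boundary (a - b) = list_boundary a - list_boundary b"
  by (simp add: list_boundary_def frag_extend_diff)

lemma list_boundary_minus: "list_boundary (- a) = - list_boundary a"
  by (simp add: list_boundary_def frag_extend_minus)

lemma list_boundary_Cons:
  "list_boundary (frag_map ((#) l) c) = c - frag_map ((#) l) (list_boundary c)"
  using subset_UNIV[of "Poly_Mapping.keys c"]
  by (induction c rule: frag_induction) (auto simp: frag_map_diff list_boundary_diff)

lemma list_boundary_list_bd: "list_boundary (list_bd w) = 0"
  by (induction w) (auto simp: list_boundary_diff list_boundary_Cons)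

lemma list_boundary_boundary: "list_boundary (list_boundary c) = 0"
  using subset_UNIV[of "Poly_Mapping.keys c"]
  by (induction c rule: frag_induction) (auto simp: list_boundary_diff list_boundary_list_bd)

lemma list_bd_map: "list_bd (map f w) = frag_map (map f) (list_bd w)"
proof (induction w)
  case (Cons l w)
  have "frag_map ((#) (f l)) (frag_map (map f) c) = frag_map (map f) (frag_map ((#) l) c)" for c
    using subset_UNIV[of "Poly_Mapping.keys c"]
    by (induction c rule: frag_induction) (auto simp: frag_map_diff)
  then show ?case
    using Cons by (simp add: frag_map_diff)
qed simp

lemma list_boundary_map: "list_boundary (frag_map (map f) c) = frag_map (map f) (list_boundary c)"
  using subset_UNIV[of "Poly_Mapping.keys c"]
  by (induction c rule: frag_induction) (auto simp: frag_map_diff list_boundary_diff list_bd_map)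

lemma list_bd_eq_sum:
  "list_bd xs = (\<Sum>k<length xs. frag_cmul ((-1) ^ k) (frag_of (take k xs @ drop (Suc k) xs)))"
proof (induction xs)
  case (Cons x xs)
  have "frag_map ((#) x) (frag_cmul a c) = frag_cmul a (frag_map ((#) x) c)" for a c
    by (simp add: frag_map_def frag_extend_cmul)
  then show ?case
    using Cons by (simp add: sum.lessThan_Suc_shift frag_map_sum flip: sum_negf del: sum.lessThan_Suc)
qed simp

text \<open>These are the simplices with \<open>n\<close> vertices of the join of the discrete sets
  on which \<open>d\<close> is constant; a simplex has at most one vertex from each set.\<close>

definition strict_lists :: "('l \<Rightarrow> nat) \<Rightarrow> 'l set \<Rightarrow> nat \<Rightarrow> 'l list set" where
  "strict_lists d Z n = {w. sorted_wrt (\<lambda>x y. d x < d y) w \<and> set w \<subseteq> Z \<and> length w = n}"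

lemma keys_list_bd:
  "w \<in> strict_lists d Z (Suc n) \<Longrightarrow> Poly_Mapping.keys (list_bd w) \<subseteq> strict_lists d Z n"
proof (induction w arbitrary: Z n)
  case (Cons l w)
  have w: "w \<in> strict_lists d Z n" "l \<in> Z"
    using Cons.prems by (auto simp: strict_lists_def)
  have "Poly_Mapping.keys (frag_map ((#) l) (list_bd w)) \<subseteq> strict_lists d Z n"
  proof (cases n)
    case 0
    then show ?thesis
      using w by (simp add: strict_lists_def)
  next
    case (Suc m)
    \<comment> \<open>Shrinking \<open>Z\<close> records in the induction that all entries of the
      tail lie above \<open>l\<close>, so that \<open>l\<close> may be put back in front.\<close>
    have "w \<in> strict_lists d {z \<in> Z. d l < d z} (Suc m)"
      using Cons.prems Suc by (auto simp: strict_lists_def)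
    from Cons.IH[OF this] show ?thesis
      by (rule keys_frag_map) (use w Suc in \<open>auto simp: strict_lists_def\<close>)
  qed
  then show ?case
    unfolding list_bd.simps using w by (intro keys_subset_diff) auto
qed (simp add: strict_lists_def)

text \<open>The exterior product of \<open>l\<close> with a basis element; each transposition costs
  a sign. The value 0 at equal \<open>d\<close> is right for equal labels. Different labels with
  equal \<open>d\<close> span no simplex of the join; the boundary formulas exclude them by
  \<open>inj_on d\<close>.\<close>

primrec ins :: "('l \<Rightarrow> nat) \<Rightarrow> 'l \<Rightarrow> 'l list \<Rightarrow> ('l list \<Rightarrow>\<^sub>0 int)" where
  "ins d l [] = frag_of [l]"
| "ins d l (x # xs) =
     (if d l < d x then frag_of (l # x # xs)
      else if d l = d x then 0 else - frag_map ((#) x) (ins d l xs))"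

text \<open>The wedge product of the labels, expanded in the basis of strictly increasing lists.\<close>

primrec wedge :: "('l \<Rightarrow> nat) \<Rightarrow> 'l list \<Rightarrow> ('l list \<Rightarrow>\<^sub>0 int)" where
  "wedge d [] = frag_of []"
| "wedge d (l # w) = frag_extend (ins d l) (wedge d w)"

lemma keys_ins:
  "w \<in> strict_lists d Z n \<Longrightarrow> l \<in> Z \<Longrightarrow> Poly_Mapping.keys (ins d l w) \<subseteq> strict_lists d Z (Suc n)"
proof (induction w arbitrary: Z n)
  case (Cons x w)
  consider "d l < d x" | "d l = d x" | "d x < d l"
    by linarith
  then show ?case
  proof cases
    case 1
    then show ?thesis
      using Cons.prems by (auto simp: strict_lists_def)
  next
    case 3
    obtain m where n: "n = Suc m"
      using Cons.prems by (auto simp: strict_lists_def)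
    have "w \<in> strict_lists d {z \<in> Z. d x < d z} m"
      using Cons.prems n by (auto simp: strict_lists_def)
    from Cons.IH[OF this] have "Poly_Mapping.keys (ins d l w) \<subseteq> strict_lists d {z \<in> Z. d x < d z} n"
      using 3 Cons.prems n by auto
    then have "Poly_Mapping.keys (frag_map ((#) x) (ins d l w)) \<subseteq> strict_lists d Z (Suc n)"
      by (rule keys_frag_map) (use Cons.prems in \<open>auto simp: strict_lists_def\<close>)
    then show ?thesis
      using 3 by auto
  qed simp
qed (auto simp: strict_lists_def)

lemma keys_wedge: "set w \<subseteq> Z \<Longrightarrow> Poly_Mapping.keys (wedge d w) \<subseteq> strict_lists d Z (length w)"
proof (induction w)
  case (Cons l w)
  then have "Poly_Mapping.keys (wedge d w) \<subseteq> strict_lists d Z (length w)"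
    by simp
  then show ?case
    unfolding wedge.simps length_Cons
    by (rule keys_frag_extend_subset) (rule keys_ins, use Cons.prems in auto)
qed (simp add: strict_lists_def)

lemma ins_Cons_greater:
  "d x < d l \<Longrightarrow> frag_extend (ins d l) (frag_map ((#) x) c) = - frag_map ((#) x) (frag_extend (ins d l) c)"
  using subset_UNIV[of "Poly_Mapping.keys c"]
  by (induction c rule: frag_induction) (auto simp: frag_map_diff frag_extend_diff)

lemma ins_Cons_same: "frag_extend (ins d l) (frag_map ((#) l) c) = 0"
  using subset_UNIV[of "Poly_Mapping.keys c"]
  by (induction c rule: frag_induction) (auto simp: frag_map_diff frag_extend_diff)

lemma ins_less:
  assumes "w \<in> strict_lists d {z. d l < d z} n"
  shows "ins d l w = frag_of (l # w)"
  using assms by (cases w) (auto simp: strict_lists_def)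

lemma extend_ins_less:
  assumes "Poly_Mapping.keys c \<subseteq> strict_lists d {z. d l < d z} n"
  shows "frag_extend (ins d l) c = frag_map ((#) l) c"
  using assms
  by (induction c rule: frag_induction) (auto simp: frag_map_diff frag_extend_diff ins_less)

lemma frag_map_minus: "frag_map f (- c) = - frag_map f c"
  by (simp add: frag_map_def frag_extend_minus)

text \<open>The boundary is a graded derivation of the exterior product. By injectivity of
  \<open>d\<close>, equal \<open>d\<close> means equal labels, where the product has to
  vanish.\<close>

lemma list_boundary_ins:
  assumes "w \<in> strict_lists d Z n" "inj_on d (insert l (set w))"
  shows "list_boundary (ins d l w) = frag_of w - frag_extend (ins d l) (list_bd w)"
  using assms
proof (induction w arbitrary: n)
  case (Cons x w)
  obtain m where n: "n = Suc m"
    using Cons.prems by (auto simp: strict_lists_def)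
  have w: "w \<in> strict_lists d Z m" "w \<in> strict_lists d {z. d x < d z} m"
    using Cons.prems n by (auto simp: strict_lists_def)
  consider "d l < d x" | "l = x" | "d x < d l"
    using Cons.prems(2) by (metis inj_on_insert insertI1 inj_onD insertCI linorder_neqE_nat list.simps(15))
  then show ?case
  proof cases
    case 1
    have "x # w \<in> strict_lists d {z. d l < d z} n"
      using Cons.prems 1 by (auto simp: strict_lists_def)
    then have "frag_extend (ins d l) (list_bd (x # w)) = frag_map ((#) l) (list_bd (x # w))"
      unfolding n by (intro extend_ins_less keys_list_bd)
    then show ?thesis
      using 1 by simp
  next
    \<comment> \<open>The left-hand side is 0. On the right, inserting \<open>l\<close> into the
      leading face \<open>w\<close> gives \<open>l # w\<close>, which cancels the first term, and
      all other faces contain \<open>l\<close> already.\<close>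
    case 2
    then show ?thesis
      using w by (simp add: frag_extend_diff ins_Cons_same ins_less)
  next
    case 3
    have "inj_on d (insert l (set w))"
      using Cons.prems(2) by (rule inj_on_subset) auto
    with Cons.IH[OF w(1)] 3 show ?thesis
      by (simp add: list_boundary_minus list_boundary_Cons frag_map_diff frag_extend_diff ins_Cons_greater)
  qed
qed simp

text \<open>By induction from the derivation rule. Lists with repeated labels are included, so
  degenerate simplices need no separate treatment.\<close>

lemma list_boundary_wedge:
  "inj_on d (set w) \<Longrightarrow> list_boundary (wedge d w) = frag_extend (wedge d) (list_bd w)"
proof (induction w)
  case (Cons l w)
  have inj: "inj_on d (set w)" "inj_on d (insert l (set w))"
    using Cons.prems by auto
  have "Poly_Mapping.keys c \<subseteq> strict_lists d (set w) n \<Longrightarrow>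
    list_boundary (frag_extend (ins d l) c) = c - frag_extend (ins d l) (list_boundary c)" for c n
  proof (induction c rule: frag_induction)
    case (one v)
    then have "inj_on d (insert l (set v))"
      by (intro inj_on_subset[OF inj(2)]) (auto simp: strict_lists_def)
    then show ?case
      using one by (simp add: list_boundary_ins)
  qed (auto simp: frag_extend_diff list_boundary_diff)
  from this[OF keys_wedge]
  have "list_boundary (wedge d (l # w)) = wedge d w - frag_extend (ins d l) (list_boundary (wedge d w))"
    by simp
  also have "list_boundary (wedge d w) = frag_extend (wedge d) (list_bd w)"
    using Cons.IH inj by simp
  also have "frag_extend (ins d l) (frag_extend (wedge d) c) = frag_extend (wedge d) (frag_map ((#) l) c)" for c
    using subset_UNIV[of "Poly_Mapping.keys c"]
    by (induction c rule: frag_induction) (auto simp: frag_map_diff frag_extend_diff)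
  finally show ?case
    by (simp add: frag_extend_diff)
qed simp

lemma ins_map:
  assumes "\<And>x. x \<in> insert l (set w) \<Longrightarrow> d (f x) = d x"
  shows "ins d (f l) (map f w) = frag_map (map f) (ins d l w)"
  using assms
proof (induction w)
  case (Cons x w)
  have "frag_map ((#) (f x)) (frag_map (map f) c) = frag_map (map f) (frag_map ((#) x) c)" for c
    using subset_UNIV[of "Poly_Mapping.keys c"]
    by (induction c rule: frag_induction) (auto simp: frag_map_diff)
  moreover have "ins d (f l) (map f w) = frag_map (map f) (ins d l w)"
    using Cons.prems by (intro Cons.IH) auto
  ultimately show ?case
    using Cons.prems by (auto simp: frag_map_minus)
qed simp

lemma wedge_map:
  assumes "\<And>x. x \<in> set w \<Longrightarrow> d (f x) = d x"
  shows "wedge d (map f w) = frag_map (map f) (wedge d w)"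
  using assms
proof (induction w)
  case (Cons l w)
  have "Poly_Mapping.keys c \<subseteq> strict_lists d (set w) n \<Longrightarrow>
    frag_extend (ins d (f l)) (frag_map (map f) c) = frag_map (map f) (frag_extend (ins d l) c)" for c n
  proof (induction c rule: frag_induction)
    case (one v)
    then have "ins d (f l) (map f v) = frag_map (map f) (ins d l v)"
      using Cons.prems by (intro ins_map) (auto simp: strict_lists_def)
    then show ?case
      by simp
  qed (auto simp: frag_map_diff frag_extend_diff)
  from this[OF keys_wedge] Cons show ?case
    by simp
qed simp

text \<open>By Bezout some multiple of \<open>i\<close> is 1 modulo \<open>p\<close>, so on
  \<open>x\<close> the map \<open>f\<close> agrees with a power of \<open>f ^^ i\<close>.\<close>

lemma funpow_prime_period:
  fixes f :: "'a \<Rightarrow> 'a"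
  assumes "prime p" "(f ^^ p) x = x" "0 < i" "i < p" "(f ^^ i) x = x"
  shows "f x = x"
proof -
  have "gcd i p = 1"
    using assms by (metis coprime_commute coprime_iff_gcd_eq_1 nat_dvd_not_less prime_imp_coprime)
  then obtain k m where km: "i * k = p * m + 1"
    using bezout_nat[of i p] assms by auto
  have "f x = f ((f ^^ (p * m)) x)"
    using funpow_mod_eq[OF assms(2), of "p * m"] by simp
  also have "\<dots> = (f ^^ (i * k)) x"
    unfolding km by simp
  also have "\<dots> = x"
    using funpow_mod_eq[OF assms(5), of "i * k"] by simp
  finally show ?thesis .
qed

lemma funpow_map:
  fixes f :: "'a \<Rightarrow> 'a"
  shows "(map f ^^ i) w = map (f ^^ i) w"
  by (induction i) auto

lemma strict_lists_length_le:
  assumes "w \<in> strict_lists d Z n" "\<And>z. z \<in> Z \<Longrightarrow> d z < D"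
  shows "n \<le> D"
proof -
  have "sorted_wrt (<) (map d w)"
    using assms(1) by (simp add: strict_lists_def sorted_wrt_map)
  then have "distinct (map d w)"
    by (simp add: strict_sorted_iff)
  then have "n = card (d ` set w)"
    using assms(1) distinct_card[of "map d w"] by (simp add: strict_lists_def)
  also have "\<dots> \<le> card {..<D}"
    using assms by (intro card_mono) (auto simp: strict_lists_def)
  finally show ?thesis
    by simp
qed

lemma list_boundary_funpow_map:
  fixes f :: "'l \<Rightarrow> 'l"
  shows "list_boundary ((frag_map (map f) ^^ i) c) = (frag_map (map f) ^^ i) (list_boundary c)"
  by (induction i) (auto simp: list_boundary_map)

section \<open>Tate sequences in the join of the label sets\<close>

locale label_action =
  fixes Z :: "'l set" and d :: "'l \<Rightarrow> nat" and f :: "'l \<Rightarrow> 'l" and p D :: nat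
  assumes closed: "z \<in> Z \<Longrightarrow> f z \<in> Z"
    and d_f: "z \<in> Z \<Longrightarrow> d (f z) = d z"
    and period: "z \<in> Z \<Longrightarrow> (f ^^ p) z = z"
    and prime: "prime p"
    and bounded: "z \<in> Z \<Longrightarrow> d z < D"
    and moved: "z \<in> Z \<Longrightarrow> 0 < d z \<Longrightarrow> f z \<noteq> z"
begin

abbreviation chains :: "nat \<Rightarrow> ('l list \<Rightarrow>\<^sub>0 int) set" where
  "chains n \<equiv> {c. Poly_Mapping.keys c \<subseteq> strict_lists d Z (Suc n)}"

lemma map_f_strict_lists: "w \<in> strict_lists d Z n \<Longrightarrow> map f w \<in> strict_lists d Z n"
  by (auto simp: strict_lists_def sorted_wrt_map closed d_f subset_iff elim!: sorted_wrt_mono_rel[rotated])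

lemma map_f_period: "w \<in> strict_lists d Z n \<Longrightarrow> (map f ^^ p) w = w"
  by (auto simp: strict_lists_def funpow_map period subset_iff intro!: map_idI)

lemma keys_map_f:
  "Poly_Mapping.keys c \<subseteq> strict_lists d Z n \<Longrightarrow>
    Poly_Mapping.keys (frag_map (map f) c) \<subseteq> strict_lists d Z n"
  by (erule keys_frag_map) (auto simp: map_f_strict_lists)

lemma keys_list_boundary:
  "Poly_Mapping.keys c \<subseteq> strict_lists d Z (Suc n) \<Longrightarrow>
    Poly_Mapping.keys (list_boundary c) \<subseteq> strict_lists d Z n"
  unfolding list_boundary_def by (erule keys_frag_extend_subset) (rule keys_list_bd)

lemma frag_map_period:
  assumes "Poly_Mapping.keys c \<subseteq> strict_lists d Z n"
  shows "(frag_map (map f) ^^ p) c = c"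
  using assms
  by (induction c rule: frag_induction) (auto simp: frag_map_funpow map_f_period frag_map_funpow_diff)

sublocale cyclic_complex chains "\<lambda>_. list_boundary" "\<lambda>_. frag_map (map f)" p
  by unfold_locales
    (simp_all add: keys_subset_diff list_boundary_diff frag_map_diff list_boundary_boundary
      list_boundary_map keys_map_f keys_list_boundary frag_map_period)

text \<open>In a strictly increasing list with two entries the second has positive \<open>d\<close>
  and is therefore moved. As \<open>p\<close> is prime, no shorter period is possible, so the basis
  is permuted freely and \<open>contr\<close> and \<open>wrap\<close> give preimages. Single
  vertices may be fixed, which explains the condition in degree 0.\<close>

lemma exact:
  assumes "0 < n \<or> (\<forall>z\<in>Z. f z \<noteq> z)" and c: "c \<in> chains n" "tate t n c = 0"
  shows "c \<in> tate (\<not> t) n ` chains n"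
proof -
  interpret free_cyclic "map f" p "strict_lists d Z (Suc n)"
  proof
    fix w i assume w: "w \<in> strict_lists d Z (Suc n)" and i: "0 < i" "i < p"
    have "\<exists>z\<in>set w. f z \<noteq> z"
    proof (cases "n = 0")
      case True
      then show ?thesis
        using assms(1) w by (cases w) (auto simp: strict_lists_def)
    next
      case False
      then obtain x y v where "w = x # y # v"
        using w by (cases w rule: list.exhaust[of _ thesis]; cases "tl w") (auto simp: strict_lists_def)
      then show ?thesis
        using w moved[of y] by (auto simp: strict_lists_def)
    qed
    then obtain z where z: "z \<in> set w" "f z \<noteq> z"
      by blast
    then have "(f ^^ i) z \<noteq> z"
      using funpow_prime_period[OF prime, of f z i] period[of z] i w by (auto simp: strict_lists_def)
    then show "(map f ^^ i) w \<noteq> w"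
      using z(1) unfolding funpow_map by (metis map_eq_conv map_ident)
  qed (use map_f_strict_lists map_f_period prime in \<open>auto simp: prime_gt_0_nat\<close>)
  have keys: "Poly_Mapping.keys c \<subseteq> strict_lists d Z (Suc n)"
    using c by simp
  show ?thesis
  proof (cases t)
    case True
    then have "tate (\<not> t) n (wrap c) = c"
      using c(2) homotopy2[OF keys] by (simp add: tate_def norm_def contr_def)
    moreover have "tate (\<not> t) n (wrap c) \<in> tate (\<not> t) n ` chains n"
      using keys_wrap[OF keys] by (intro imageI) simp
    ultimately show ?thesis
      by (simp only:)
  next
    case False
    then have "tate (\<not> t) n (contr c) = c"
      using c(2) homotopy1[OF keys] by (simp add: tate_def norm_def wrap_def)
    moreover have "tate (\<not> t) n (contr c) \<in> tate (\<not> t) n ` chains n"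
      using keys_contr[OF keys] by (intro imageI) simp
    ultimately show ?thesis
      by (simp only:)
  qed
qed

lemma chains_trivial: "D \<le> n \<Longrightarrow> chains n = {0}"
proof -
  assume "D \<le> n"
  then have "strict_lists d Z (Suc n) = {}"
    using strict_lists_length_le[OF _ bounded, where n = "Suc n"] by fastforce
  then show ?thesis
    by auto
qed

lemma descend:
  assumes "tate_seq s m R c" "m \<le> R" "D \<le> R" "0 < m \<or> (\<forall>z\<in>Z. f z \<noteq> z)"
  shows "\<exists>e\<in>chains (Suc m). \<exists>e'\<in>chains m. c m = list_boundary e + tate (even (m + s)) m e'"
  by (rule tate_seq_descend[OF assms(1,2) chains_trivial[OF assms(3)]]) (use assms(4) in \<open>auto intro!: exact\<close>)

text \<open>Applied to \<open>[u]\<close> with a fixed label \<open>u\<close>, this concerns the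
  coefficient of a vertex; applied to \<open>[]\<close>, which every map fixes, it concerns the
  augmentation.\<close>

lemma dvd_lookup_boundary_norm:
  assumes "e \<in> chains n" "map f w = w"
  shows "int p dvd poly_mapping.lookup (list_boundary (norm n e)) w"
proof -
  have "list_boundary (norm n e) = (\<Sum>i<p. (frag_map (map f) ^^ i) (list_boundary e))"
    using assms(1) by (cases n) (simp_all add: norm_def d_sum list_boundary_funpow_map)
  moreover have "Poly_Mapping.keys (list_boundary e) \<subseteq> strict_lists d Z n"
    using assms(1) keys_list_boundary by simp
  ultimately show ?thesis
    using dvd_lookup_norm_fixed[of "list_boundary e" "strict_lists d Z n" "map f" p w] assms(2)
      map_f_strict_lists map_f_period by metis
qed

lemma no_tate_seq_from_1:
  assumes "tate_seq 0 1 R c" "1 \<le> R" "D \<le> R"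
    and "list_boundary (c 1) = frag_of [v] - frag_of [u]" "u \<noteq> v" "f u = u"
  shows False
proof -
  obtain e e' where e: "e \<in> chains (Suc 1)" "e' \<in> chains 1" "c 1 = list_boundary e + norm 1 e'"
    using descend[OF assms(1,2,3)] by (auto simp: tate_def)
  have "list_boundary (c 1) = list_boundary (norm 1 e')"
    unfolding e(3) by (simp add: d_add list_boundary_boundary)
  then have "int p dvd poly_mapping.lookup (frag_of [v] - frag_of [u]) [u]"
    using dvd_lookup_boundary_norm[OF e(2), of "[u]"] assms by simp
  then have "int p dvd - 1"
    using assms(5) by (simp add: lookup_minus lookup_single when_def)
  then show False
    using prime by (simp add: not_prime_1)
qed

lemma no_tate_seq_from_0:
  assumes "tate_seq 1 0 R c" "D \<le> R" "\<forall>z\<in>Z. f z \<noteq> z" and "c 0 = frag_of [u]"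
  shows False
proof -
  obtain e e' where e: "e \<in> chains (Suc 0)" "e' \<in> chains 0" "c 0 = list_boundary e + norm 0 e'"
    using descend[OF assms(1) _ assms(2)] assms(3) by (auto simp: tate_def)
  have "list_boundary (c 0) = list_boundary (norm 0 e')"
    unfolding e(3) by (simp add: d_add list_boundary_boundary)
  then have "int p dvd poly_mapping.lookup (list_boundary (frag_of [u])) []"
    using dvd_lookup_boundary_norm[OF e(2), of "[]"] assms by simp
  then have "int p dvd 1"
    by (simp add: lookup_single when_def)
  then show False
    using prime by (simp add: not_prime_1)
qed

end

section \<open>From singular chains to chains on labels\<close>

definition vertex :: "nat \<Rightarrow> nat \<Rightarrow> real" where
  "vertex i = (\<lambda>j. if j = i then 1 else 0)"

lemma vertex_in [simp]: "vertex i \<in> standard_simplex n \<longleftrightarrow> i \<le> n"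
  by (simp add: vertex_def)

lemma simplical_face_vertex: "simplical_face k (vertex i) = vertex (if i < k then i else Suc i)"
  by (auto simp: simplical_face_def vertex_def fun_eq_iff)

definition vertex_labels :: "('x \<Rightarrow> 'l) \<Rightarrow> nat \<Rightarrow> ((nat \<Rightarrow> real) \<Rightarrow> 'x) \<Rightarrow> 'l list" where
  "vertex_labels lam n \<sigma> = map (\<lambda>i. lam (\<sigma> (vertex i))) [0..<Suc n]"

lemma length_vertex_labels [simp]: "length (vertex_labels lam n \<sigma>) = Suc n"
  by (simp add: vertex_labels_def)

text \<open>Simplicial approximation on the level of chains: a singular simplex goes to the oriented
  simplex spanned by the labels of its vertices, without any continuous map being formed.\<close>

definition label_chain :: "('x \<Rightarrow> 'l) \<Rightarrow> ('l \<Rightarrow> nat) \<Rightarrow> nat \<Rightarrow> 'x chain \<Rightarrow> ('l list \<Rightarrow>\<^sub>0 int)" where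
  "label_chain lam d n = frag_extend (\<lambda>\<sigma>. wedge d (vertex_labels lam n \<sigma>))"

lemma label_chain_diff: "label_chain lam d n (a - b) = label_chain lam d n a - label_chain lam d n b"
  by (simp add: label_chain_def frag_extend_diff)

lemma vertex_labels_face:
  assumes "k \<le> Suc n"
  shows "vertex_labels lam n (singular_face (Suc n) k \<sigma>) =
    take k (vertex_labels lam (Suc n) \<sigma>) @ drop (Suc k) (vertex_labels lam (Suc n) \<sigma>)"
proof (rule nth_equalityI)
  show "length (vertex_labels lam n (singular_face (Suc n) k \<sigma>)) =
    length (take k (vertex_labels lam (Suc n) \<sigma>) @ drop (Suc k) (vertex_labels lam (Suc n) \<sigma>))"
    using assms by (simp add: vertex_labels_def)
  fix i assume "i < length (vertex_labels lam n (singular_face (Suc n) k \<sigma>))"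
  then have i: "i \<le> n"
    by (simp add: vertex_labels_def)
  then show "vertex_labels lam n (singular_face (Suc n) k \<sigma>) ! i =
    (take k (vertex_labels lam (Suc n) \<sigma>) @ drop (Suc k) (vertex_labels lam (Suc n) \<sigma>)) ! i"
    using assms
    by (simp add: vertex_labels_def nth_append singular_face_def simplical_face_vertex
        del: upt_Suc)
qed

text \<open>The condition says that different labels on one simplex have different \<open>d\<close>,
  so that they span a simplex of the join. Only then is \<open>wedge\<close> compatible with the
  faces.\<close>

lemma label_chain_boundary:
  assumes "\<And>\<sigma>. \<sigma> \<in> Poly_Mapping.keys c \<Longrightarrow> inj_on d (set (vertex_labels lam (Suc n) \<sigma>))"
  shows "label_chain lam d n (chain_boundary (Suc n) c) = list_boundary (label_chain lam d (Suc n) c)"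
proof -
  have "Poly_Mapping.keys c \<subseteq> {\<sigma>. inj_on d (set (vertex_labels lam (Suc n) \<sigma>))}"
    using assms by blast
  then show ?thesis
  proof (induction c rule: frag_induction)
    case (one \<sigma>)
    have "label_chain lam d n (chain_boundary (Suc n) (frag_of \<sigma>)) =
        (\<Sum>k\<le>Suc n. frag_cmul ((-1) ^ k) (wedge d (vertex_labels lam n (singular_face (Suc n) k \<sigma>))))"
      unfolding chain_boundary_of label_chain_def
      by (subst if_not_P) (simp_all add: frag_extend_sum frag_extend_cmul o_def del: sum.atMost_Suc)
    also have "\<dots> = frag_extend (wedge d) (list_bd (vertex_labels lam (Suc n) \<sigma>))"
      unfolding list_bd_eq_sum
      by (subst frag_extend_sum)
        (auto simp: frag_extend_cmul vertex_labels_face lessThan_Suc_atMost o_def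
          intro!: sum.cong simp del: sum.atMost_Suc)
    also have "\<dots> = list_boundary (label_chain lam d (Suc n) (frag_of \<sigma>))"
      using one by (simp add: label_chain_def list_boundary_wedge)
    finally show ?case .
  qed (auto simp: label_chain_def chain_boundary_diff frag_extend_diff list_boundary_diff)
qed

lemma label_chain_map:
  assumes "singular_chain n X c"
    and "\<And>x. x \<in> topspace X \<Longrightarrow> lam (g x) = h (lam x)"
    and "\<And>x. x \<in> topspace X \<Longrightarrow> d (h (lam x)) = d (lam x)"
  shows "label_chain lam d n (chain_map n g c) = frag_map (map h) (label_chain lam d n c)"
  using assms(1) unfolding singular_chain_def
proof (induction c rule: frag_induction)
  case (one \<sigma>)
  then have \<sigma>: "\<sigma> (vertex i) \<in> topspace X" if "i \<le> n" for i
    using that vertex_in[of i n] by (fastforce simp: singular_simplex_def continuous_map_def)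
  have "vertex_labels lam n (simplex_map n g \<sigma>) = map h (vertex_labels lam n \<sigma>)"
    using \<sigma> assms(2) by (simp add: vertex_labels_def simplex_map_def)
  then show ?case
    using \<sigma> assms(3) by (simp add: label_chain_def) (subst wedge_map, auto simp: vertex_labels_def)
qed (auto simp: label_chain_def chain_map_diff frag_extend_diff frag_map_diff)

lemma keys_label_chain:
  assumes "singular_chain n X c" "lam ` topspace X \<subseteq> Z"
  shows "Poly_Mapping.keys (label_chain lam d n c) \<subseteq> strict_lists d Z (Suc n)"
  unfolding label_chain_def
proof (rule keys_frag_extend_subset)
  show "Poly_Mapping.keys c \<subseteq> {\<sigma>. singular_simplex n X \<sigma>}"
    using assms(1) by (simp add: singular_chain_def)
  fix \<sigma> assume "\<sigma> \<in> {\<sigma>. singular_simplex n X \<sigma>}"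
  then have \<sigma>: "\<sigma> (vertex i) \<in> topspace X" if "i \<le> n" for i
    using that vertex_in[of i n] by (fastforce simp: singular_simplex_def continuous_map_def)
  have "set (vertex_labels lam n \<sigma>) \<subseteq> Z"
    using \<sigma> assms(2) by (auto simp: vertex_labels_def)
  from keys_wedge[OF this] show "Poly_Mapping.keys (wedge d (vertex_labels lam n \<sigma>)) \<subseteq> strict_lists d Z (Suc n)"
    by (simp add: vertex_labels_def)
qed

lemma chain_map_funpow:
  fixes f :: "'x \<Rightarrow> 'x"
  assumes "singular_chain n X c" "continuous_map X X f"
  shows "(chain_map n f ^^ i) c = chain_map n (f ^^ i) c"
proof (induction i)
  case 0
  then show ?case
    using assms(1) by (simp add: chain_map_ident flip: id_def)
next
  case (Suc i)
  have "chain_map n (f ^^ Suc i) c = chain_map n f (chain_map n (f ^^ i) c)"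
    using chain_map_compose[of n f "f ^^ i"] by (simp only: funpow.simps o_apply)
  with Suc show ?case
    by (metis funpow.simps(2) o_apply)
qed

lemma singular_cyclic_complex:
  fixes f :: "'x \<Rightarrow> 'x"
  assumes "continuous_map X X f" "\<And>x. x \<in> topspace X \<Longrightarrow> (f ^^ p) x = x"
  shows "cyclic_complex (\<lambda>n. {c. singular_chain n X c}) (\<lambda>n. chain_boundary (Suc n)) (\<lambda>n. chain_map n f) p"
proof
  show "(chain_map n f ^^ p) c = c" if "c \<in> {c. singular_chain n X c}" for n c
    using that assms by (simp add: chain_map_funpow chain_map_id_gen)
  show "chain_boundary (Suc n) (chain_boundary (Suc (Suc n)) c) = 0"
    if "c \<in> {c. singular_chain (Suc (Suc n)) X c}" for n c
    using that chain_boundary_boundary[of "Suc (Suc n)" X c] by simp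
  show "chain_boundary (Suc n) (chain_map (Suc n) f c) = chain_map n f (chain_boundary (Suc n) c)"
    if "c \<in> {c. singular_chain (Suc n) X c}" for n c
    using that chain_boundary_chain_map[of "Suc n" X c f] by simp
qed (use assms in \<open>auto intro: singular_chain_diff singular_chain_boundary_alt singular_chain_chain_map
  simp: chain_boundary_diff chain_map_diff\<close>)

lemma singular_chain_subdivision_funpow:
  "singular_chain n X c \<Longrightarrow> singular_chain n X ((singular_subdivision n ^^ i) c)"
  by (induction i) (auto intro: singular_chain_singular_subdivision)

lemma chain_map_subdivision_funpow:
  assumes "singular_chain n X c"
  shows "(singular_subdivision n ^^ i) (chain_map n g c) = chain_map n g ((singular_subdivision n ^^ i) c)"
  by (induction i)
    (auto simp: naturality_singular_subdivision[OF singular_chain_subdivision_funpow[OF assms]])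

lemma chain_boundary_subdivision_funpow:
  assumes "singular_chain (Suc n) X c"
  shows "chain_boundary (Suc n) ((singular_subdivision (Suc n) ^^ i) c) =
    (singular_subdivision n ^^ i) (chain_boundary (Suc n) c)"
  by (induction i)
    (auto simp: chain_boundary_singular_subdivision[OF singular_chain_subdivision_funpow[OF assms]])

lemma subdivision_funpow_degree_0:
  "singular_chain 0 X c \<Longrightarrow> (singular_subdivision 0 ^^ i) c = c"
  by (induction i) (auto simp: singular_subdivision_zero)

definition point :: "'x \<Rightarrow> (nat \<Rightarrow> real) \<Rightarrow> 'x" where
  "point x = restrict (\<lambda>_. x) (standard_simplex 0)"

lemma singular_simplex_point: "x \<in> topspace X \<Longrightarrow> singular_simplex 0 X (point x)"
  by (simp add: singular_simplex_def point_def)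

lemma simplex_map_point: "simplex_map 0 g (point x) = point (g x)"
  by (auto simp: simplex_map_def point_def)

text \<open>Labels are of the same type as points, so one map \<open>f\<close> acts on both.
  \<open>lam_locally_inj\<close> plays the role of the star condition of simplicial approximation;
  \<open>lam\<close> itself is not assumed continuous.\<close>

locale labelled_space = label_action Z d f p D
  for Z :: "'x set" and d f p D +
  fixes X :: "'x topology" and lam :: "'x \<Rightarrow> 'x"
  assumes f_cont: "continuous_map X X f"
    and f_period: "x \<in> topspace X \<Longrightarrow> (f ^^ p) x = x"
    and lam_in: "x \<in> topspace X \<Longrightarrow> lam x \<in> Z"
    and lam_f: "x \<in> topspace X \<Longrightarrow> lam (f x) = f (lam x)"
    and lam_locally_inj: "x \<in> topspace X \<Longrightarrow> \<exists>U. openin X U \<and> x \<in> U \<and> inj_on d (lam ` U)"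
begin

sublocale sing: cyclic_complex "\<lambda>n. {c. singular_chain n X c}" "\<lambda>n. chain_boundary (Suc n)"
  "\<lambda>n. chain_map n f" p
  by (rule singular_cyclic_complex[OF f_cont f_period])

text \<open>The open sets on which different labels have different \<open>d\<close> cover the space.
  The number of subdivisions that makes a chain subordinate to this cover depends on the chain,
  whence the maximum over finitely many degrees.\<close>

lemma fine_subdivision:
  assumes "\<And>n. n \<le> R \<Longrightarrow> singular_chain n X (c n)"
  obtains M where "\<And>n \<sigma>. n \<le> R \<Longrightarrow> \<sigma> \<in> Poly_Mapping.keys ((singular_subdivision n ^^ M) (c n)) \<Longrightarrow>
    inj_on d (set (vertex_labels lam n \<sigma>))"
proof -
  define \<C> where "\<C> = {U. openin X U \<and> inj_on d (lam ` U)}"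
  have cover: "topspace X \<subseteq> \<Union>\<C>"
    using lam_locally_inj by (auto simp: \<C>_def)
  have "\<exists>N. \<forall>M \<sigma>. N \<le> M \<longrightarrow> \<sigma> \<in> Poly_Mapping.keys ((singular_subdivision n ^^ M) (c n)) \<longrightarrow>
    (\<exists>V\<in>\<C>. \<sigma> \<in> standard_simplex n \<rightarrow> V)" if n: "n \<le> R" for n
  proof (rule sufficient_iterated_singular_subdivision_exists[OF _ cover assms[OF n]])
    show "openin X U" if "U \<in> \<C>" for U
      using that by (simp add: \<C>_def)
  qed blast
  then obtain N where N: "\<And>n M \<sigma>. n \<le> R \<Longrightarrow> N n \<le> M \<Longrightarrow>
      \<sigma> \<in> Poly_Mapping.keys ((singular_subdivision n ^^ M) (c n)) \<Longrightarrow> \<exists>V\<in>\<C>. \<sigma> \<in> standard_simplex n \<rightarrow> V"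
    by metis
  show ?thesis
  proof
    fix n \<sigma>
    assume n: "n \<le> R" and "\<sigma> \<in> Poly_Mapping.keys ((singular_subdivision n ^^ Max (N ` {..R})) (c n))"
    moreover have "N n \<le> Max (N ` {..R})"
      using n by (intro Max_ge) auto
    ultimately obtain V where V: "V \<in> \<C>" "\<sigma> \<in> standard_simplex n \<rightarrow> V"
      using N by blast
    then have "set (vertex_labels lam n \<sigma>) \<subseteq> lam ` V"
      by (auto simp: vertex_labels_def)
    then show "inj_on d (set (vertex_labels lam n \<sigma>))"
      using V(1) by (auto simp: \<C>_def intro: inj_on_subset)
  qed
qed

definition \<Lambda> :: "nat \<Rightarrow> nat \<Rightarrow> 'x chain \<Rightarrow> ('x list \<Rightarrow>\<^sub>0 int)" where
  "\<Lambda> M n c = label_chain lam d n ((singular_subdivision n ^^ M) c)"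

lemma \<Lambda>_diff: "\<Lambda> M n (a - b) = \<Lambda> M n a - \<Lambda> M n b"
  by (simp add: \<Lambda>_def singular_subdivision_power_diff label_chain_diff)

lemma \<Lambda>_chain_map: "singular_chain n X c \<Longrightarrow> \<Lambda> M n (chain_map n f c) = frag_map (map f) (\<Lambda> M n c)"
  unfolding \<Lambda>_def
  by (subst chain_map_subdivision_funpow, assumption)
    (auto intro!: label_chain_map[where X = X] singular_chain_subdivision_funpow simp: lam_f d_f lam_in)

lemma \<Lambda>_0: "\<Lambda> M n 0 = 0"
  using \<Lambda>_diff[of M n 0 0] by simp

lemma \<Lambda>_add: "\<Lambda> M n (a + b) = \<Lambda> M n a + \<Lambda> M n b"
  using \<Lambda>_diff[of M n a "- b"] \<Lambda>_diff[of M n 0 b] by (simp add: \<Lambda>_0)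

lemma \<Lambda>_tate:
  assumes "singular_chain n X c"
  shows "\<Lambda> M n (sing.tate t n c) = tate t n (\<Lambda> M n c)"
proof -
  have "\<Lambda> M n ((chain_map n f ^^ i) c) = (frag_map (map f) ^^ i) (\<Lambda> M n c)" for i
  proof (induction i)
    case (Suc i)
    have "singular_chain n X ((chain_map n f ^^ i) c)"
      using sing.A_pow_S assms by blast
    then show ?case
      using Suc by (simp add: \<Lambda>_chain_map)
  qed simp
  moreover have "\<Lambda> M n (\<Sum>i\<in>I. g i) = (\<Sum>i\<in>I. \<Lambda> M n (g i))" for g and I :: "nat set"
    by (induction I rule: infinite_finite_induct) (auto simp: \<Lambda>_0 \<Lambda>_add)
  ultimately show ?thesis
    using assms by (simp add: sing.tate_def sing.norm_def tate_def norm_def \<Lambda>_diff \<Lambda>_chain_map)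
qed

text \<open>The second conclusion also covers the boundary of the first member, which lies one
  degree below the sequence; for a sequence from degree 1 this is the pair of end points.\<close>

lemma transport:
  assumes c: "sing.tate_seq s m R c"
  obtains M where "tate_seq s m R (\<lambda>n. \<Lambda> M n (c n))"
    and "\<And>n. m \<le> Suc n \<Longrightarrow> Suc n \<le> R \<Longrightarrow>
      list_boundary (\<Lambda> M (Suc n) (c (Suc n))) = \<Lambda> M n (chain_boundary (Suc n) (c (Suc n)))"
proof -
  have chain: "singular_chain n X (c n)" if "m \<le> n" "n \<le> R" for n
    using c that by (simp add: sing.tate_seq_def)
  \<comment> \<open>Nothing is known about \<open>c n\<close> below degree \<open>m\<close>; it is
    replaced by 0 there.\<close>
  obtain M where M: "\<And>n \<sigma>. n \<le> R \<Longrightarrow>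
      \<sigma> \<in> Poly_Mapping.keys ((singular_subdivision n ^^ M) (if m \<le> n then c n else 0)) \<Longrightarrow>
      inj_on d (set (vertex_labels lam n \<sigma>))"
    by (rule fine_subdivision[of R "\<lambda>n. if m \<le> n then c n else 0"]) (use chain in auto)
  have bd: "list_boundary (\<Lambda> M (Suc n) (c (Suc n))) = \<Lambda> M n (chain_boundary (Suc n) (c (Suc n)))"
    if n: "m \<le> Suc n" "Suc n \<le> R" for n
  proof -
    have "label_chain lam d n (chain_boundary (Suc n) ((singular_subdivision (Suc n) ^^ M) (c (Suc n)))) =
        list_boundary (label_chain lam d (Suc n) ((singular_subdivision (Suc n) ^^ M) (c (Suc n))))"
      using M[OF n(2)] n(1) by (intro label_chain_boundary) presburger
    moreover have "chain_boundary (Suc n) ((singular_subdivision (Suc n) ^^ M) (c (Suc n))) =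
        (singular_subdivision n ^^ M) (chain_boundary (Suc n) (c (Suc n)))"
      by (rule chain_boundary_subdivision_funpow[OF chain[OF n]])
    ultimately show ?thesis
      unfolding \<Lambda>_def by metis
  qed
  have "tate_seq s m R (\<lambda>n. \<Lambda> M n (c n))"
    unfolding tate_seq_def
  proof (intro conjI allI impI; elim conjE)
    fix n assume n: "m \<le> n" "n \<le> R"
    have "lam ` topspace X \<subseteq> Z"
      using lam_in by blast
    from keys_label_chain[OF singular_chain_subdivision_funpow[OF chain[OF n]] this]
    show "\<Lambda> M n (c n) \<in> chains n"
      unfolding \<Lambda>_def mem_Collect_eq .
  next
    fix n assume n: "m \<le> n" "n < R"
    have "tate (odd (n + s)) n (\<Lambda> M n (c n)) = \<Lambda> M n (sing.tate (odd (n + s)) n (c n))"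
      using chain[OF n(1) less_imp_le[OF n(2)]] by (rule \<Lambda>_tate[symmetric])
    also have "sing.tate (odd (n + s)) n (c n) = chain_boundary (Suc n) (c (Suc n))"
      using c n unfolding sing.tate_seq_def by blast
    also have "\<Lambda> M n \<dots> = list_boundary (\<Lambda> M (Suc n) (c (Suc n)))"
      using bd[of n] n by simp
    finally show "tate (odd (n + s)) n (\<Lambda> M n (c n)) = list_boundary (\<Lambda> M (Suc n) (c (Suc n)))" .
  qed
  from that[OF this bd] show ?thesis
    by simp
qed

lemma \<Lambda>_point: "x \<in> topspace X \<Longrightarrow> \<Lambda> M 0 (frag_of (point x)) = frag_of [lam x]"
  using singular_simplex_point[of x X]
  by (simp add: \<Lambda>_def subdivision_funpow_degree_0[of X] singular_chain_of label_chain_def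
      vertex_labels_def) (simp add: point_def)

lemma no_singular_tate_seq_from_1:
  assumes "sing.tate_seq 0 1 R c" "1 \<le> R" "D \<le> R" "x \<in> topspace X" "y \<in> topspace X"
    and "chain_boundary 1 (c 1) = frag_of (point y) - frag_of (point x)" "lam x \<noteq> lam y" "f x = x"
  shows False
proof -
  obtain M where M: "tate_seq 0 1 R (\<lambda>n. \<Lambda> M n (c n))"
    and "\<And>n. 1 \<le> Suc n \<Longrightarrow> Suc n \<le> R \<Longrightarrow>
      list_boundary (\<Lambda> M (Suc n) (c (Suc n))) = \<Lambda> M n (chain_boundary (Suc n) (c (Suc n)))"
    by (rule transport[OF assms(1)]) (rule that)
  from this(2)[of 0] have bd: "list_boundary (\<Lambda> M 1 (c 1)) = \<Lambda> M 0 (chain_boundary 1 (c 1))"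
    using assms(2) by simp
  show False
  proof (rule no_tate_seq_from_1[OF M assms(2,3)])
    show "list_boundary (\<Lambda> M 1 (c 1)) = frag_of [lam y] - frag_of [lam x]"
      unfolding bd assms(6) using assms by (simp add: \<Lambda>_diff \<Lambda>_point)
    show "f (lam x) = lam x"
      using lam_f[of x] assms by simp
  qed fact
qed

lemma no_singular_tate_seq_from_0:
  assumes "sing.tate_seq 1 0 R c" "D \<le> R" "\<forall>z\<in>Z. f z \<noteq> z" "x \<in> topspace X" "c 0 = frag_of (point x)"
  shows False
proof -
  obtain M where M: "tate_seq 1 0 R (\<lambda>n. \<Lambda> M n (c n))"
    by (rule transport[OF assms(1)]) (rule that)
  show False
    by (rule no_tate_seq_from_0[OF M assms(2,3)]) (use assms in \<open>simp add: \<Lambda>_point\<close>)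
qed

end

section \<open>Weights of cells\<close>

definition sqn :: "nat \<Rightarrow> (nat \<Rightarrow> real) \<Rightarrow> real" where
  "sqn n v = (\<Sum>i<n. v i ^ 2)"

definition radial :: "nat \<Rightarrow> (nat \<Rightarrow> real) \<Rightarrow> nat \<Rightarrow> real" where
  "radial n v = (\<lambda>i. v i / sqrt (sqn n v))"

lemma unit_disk_eq: "unit_disk n = top_of_set {v. (\<forall>i\<ge>n. v i = 0) \<and> sqn n v \<le> 1}"
  by (simp add: unit_disk_def Euclidean_space_def euclidean_product_topology subtopology_subtopology
      sqn_def Collect_conj_eq)

lemma topspace_unit_disk: "v \<in> topspace (unit_disk n) \<longleftrightarrow> (\<forall>i\<ge>n. v i = 0) \<and> sqn n v \<le> 1"
  by (simp add: unit_disk_eq)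

lemma boundary_sphere_iff: "v \<in> boundary_sphere n \<longleftrightarrow> (\<forall>i\<ge>n. v i = 0) \<and> sqn n v = 1"
  by (auto simp: boundary_sphere_def topspace_unit_disk) (auto simp: sqn_def)

lemma sqn_nonneg [simp]: "0 \<le> sqn n v"
  by (simp add: sqn_def sum_nonneg)

lemma sqn_0 [simp]: "sqn n (\<lambda>_. 0) = 0"
  by (simp add: sqn_def)

lemma radial_in_boundary:
  assumes "v \<in> topspace (unit_disk n)" "sqn n v > 0"
  shows "radial n v \<in> boundary_sphere n"
proof -
  have "sqn n (radial n v) = sqn n v / sqn n v"
    using assms(2) by (simp add: sqn_def radial_def power_divide flip: sum_divide_distrib)
  then show ?thesis
    using assms by (simp add: boundary_sphere_iff topspace_unit_disk radial_def)
qed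

lemma radial_boundary: "v \<in> boundary_sphere n \<Longrightarrow> radial n v = v"
  by (simp add: boundary_sphere_iff radial_def)

lemma continuous_on_coordinate: "continuous_on S (\<lambda>v :: 'i \<Rightarrow> 'b::topological_space. v i)"
  by (rule continuous_on_subset[OF continuous_on_product_coordinates subset_UNIV])

lemma continuous_sqn: "continuous_on S (sqn n)"
  unfolding sqn_def by (intro continuous_intros continuous_on_coordinate)

lemma continuous_radial: "continuous_on {v \<in> S. 1 / 2 \<le> sqn n v} (radial n)"
  unfolding radial_def
  by (intro continuous_on_coordinatewise_then_product continuous_on_divide continuous_on_coordinate
      continuous_on_real_sqrt continuous_sqn) auto

text \<open>On the sphere the factor is 1 and \<open>radial\<close> is the identity, so
  \<open>f\<close> is extended. For \<open>sqn n v\<close> up to 1/2 the factor vanishes and hides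
  the discontinuity of \<open>radial\<close> at the origin.\<close>

lemma continuous_radial_extension:
  assumes "continuous_map (subtopology (unit_disk n) (boundary_sphere n)) euclideanreal f"
  shows "continuous_map (unit_disk n) euclideanreal (\<lambda>v. max 0 (2 * sqn n v - 1) * f (radial n v))"
proof -
  let ?D = "{v. (\<forall>i\<ge>n. v i = 0) \<and> sqn n v \<le> 1}"
  have "boundary_sphere n \<subseteq> ?D"
    by (auto simp: boundary_sphere_iff)
  then have f: "continuous_on (boundary_sphere n) f"
    using assms by (simp add: unit_disk_eq subtopology_subtopology Int_absorb1)
  have "continuous_on {v \<in> ?D. 1 / 2 \<le> sqn n v} (\<lambda>v. f (radial n v))"
    by (rule continuous_on_compose2[OF f continuous_radial])
      (auto intro!: radial_in_boundary simp: topspace_unit_disk)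
  then have "continuous_on ?D (\<lambda>v. if sqn n v \<le> 1 / 2 then 0 else (2 * sqn n v - 1) * f (radial n v))"
    by (intro continuous_on_cases_le continuous_intros continuous_sqn) auto
  also have "(\<lambda>v. if sqn n v \<le> 1 / 2 then 0 else (2 * sqn n v - 1) * f (radial n v)) =
      (\<lambda>v. max 0 (2 * sqn n v - 1) * f (radial n v))"
    by (auto simp: fun_eq_iff max_def)
  finally show ?thesis
    by (simp add: unit_disk_eq)
qed

lemma continuous_map_from_discrete_prod:
  assumes "\<And>C. C \<in> L \<Longrightarrow> continuous_map Y T (\<lambda>v. f (C, v))"
  shows "continuous_map (prod_topology (discrete_topology L) Y) T f"
  unfolding continuous_map_def
proof (intro conjI allI impI)
  show "f \<in> topspace (prod_topology (discrete_topology L) Y) \<rightarrow> topspace T"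
    using assms by (auto simp: continuous_map_def)
  fix U assume U: "openin T U"
  have "{x \<in> topspace (prod_topology (discrete_topology L) Y). f x \<in> U} =
      (\<Union>C\<in>L. {C} \<times> {v \<in> topspace Y. f (C, v) \<in> U})"
    by auto
  also have "openin (prod_topology (discrete_topology L) Y) \<dots>"
    using assms U by (auto simp: openin_prod_Times_iff continuous_map_def intro!: openin_Union)
  finally show "openin (prod_topology (discrete_topology L) Y)
      {x \<in> topspace (prod_topology (discrete_topology L) Y). f x \<in> U}" .
qed

lemma continuous_map_from_sum_topology:
  assumes "\<And>j. j \<in> I \<Longrightarrow> continuous_map (Y j) T (\<lambda>v. f (j, v))"
  shows "continuous_map (sum_topology Y I) T f"
  unfolding continuous_map_def
proof (intro conjI allI impI)
  show "f \<in> topspace (sum_topology Y I) \<rightarrow> topspace T"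
    using assms by (fastforce simp: continuous_map_def Pi_iff)
  fix U assume U: "openin T U"
  have "{x. (j, x) \<in> {x \<in> topspace (sum_topology Y I). f x \<in> U}} = {x \<in> topspace (Y j). f (j, x) \<in> U}"
    if "j \<in> I" for j
    using that by auto
  then show "openin (sum_topology Y I) {x \<in> topspace (sum_topology Y I). f x \<in> U}"
    using assms U by (auto simp: openin_sum_topology continuous_map_def)
qed

text \<open>The weight functions of cell centres, i.e. unnormalised coordinates of an equivariant map of
  the subspace \<open>A\<close> to a join of discrete sets, one for each dimension \<open>d z\<close>.\<close>

locale cell_weights =
  fixes G :: "('g, 'm) monoid_scheme" and X :: "'x topology" and \<phi> :: "'g \<Rightarrow> 'x \<Rightarrow> 'x"
    and n :: nat and A Z :: "'x set" and d :: "'x \<Rightarrow> nat" and w :: "'x \<Rightarrow> 'x \<Rightarrow> real"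
  assumes finite_Z: "finite Z"
    and Z_sub: "Z \<subseteq> A"
    and A_sub: "A \<subseteq> topspace X"
    and d_less: "z \<in> Z \<Longrightarrow> d z < n"
    and Z_closed: "g \<in> carrier G \<Longrightarrow> z \<in> Z \<Longrightarrow> \<phi> g z \<in> Z"
    and d_invariant: "g \<in> carrier G \<Longrightarrow> z \<in> Z \<Longrightarrow> d (\<phi> g z) = d z"
    and A_closed: "g \<in> carrier G \<Longrightarrow> x \<in> A \<Longrightarrow> \<phi> g x \<in> A"
    and w_cont: "z \<in> Z \<Longrightarrow> continuous_map (subtopology X A) euclideanreal (w z)"
    and w_nonneg: "x \<in> A \<Longrightarrow> z \<in> Z \<Longrightarrow> 0 \<le> w z x"
    and w_pos: "x \<in> A \<Longrightarrow> \<exists>z\<in>Z. 0 < w z x"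
    and w_orthogonal: "x \<in> A \<Longrightarrow> z \<in> Z \<Longrightarrow> z' \<in> Z \<Longrightarrow> d z = d z' \<Longrightarrow> z \<noteq> z' \<Longrightarrow> w z x * w z' x = 0"
    and w_equivariant: "g \<in> carrier G \<Longrightarrow> x \<in> A \<Longrightarrow> z \<in> Z \<Longrightarrow> w (\<phi> g z) (\<phi> g x) = w z x"
    and Z_free: "g \<in> carrier G \<Longrightarrow> z \<in> Z \<Longrightarrow> 0 < d z \<Longrightarrow> \<phi> g z = z \<Longrightarrow> g = \<one>\<^bsub>G\<^esub>"

lemma cell_weights_empty: "cell_weights G X \<phi> 0 {} {} d w"
  by unfold_locales auto

section \<open>Extending the weights over the cells of dimension \<open>n\<close>\<close>

locale cell_attachment = cell_weights G X \<phi> n A Z d w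
  for G :: "('g, 'm) monoid_scheme" and X :: "'x topology" and \<phi> n A Z d w +
  fixes B :: "'x set" and m :: nat and H :: "nat \<Rightarrow> 'g set"
    and \<Phi> :: "nat \<times> 'g set \<times> (nat \<Rightarrow> real) \<Rightarrow> 'x"
  assumes G_space: "G_space G X \<phi>"
    and finite_G: "finite (carrier G)"
    and pseudofree: "pseudofree G X \<phi>"
    and A_B: "A \<subseteq> B" and B_sub: "B \<subseteq> topspace X"
    and H: "j < m \<Longrightarrow> subgroup (H j) G"
    and \<Phi>_cont: "continuous_map (equivariant_cells G n m H) (subtopology X B) \<Phi>"
    and \<Phi>_equivariant: "(j, C, v) \<in> topspace (equivariant_cells G n m H) \<Longrightarrow> g \<in> carrier G \<Longrightarrow>
      \<Phi> (j, g <#\<^bsub>G\<^esub> C, v) = \<phi> g (\<Phi> (j, C, v))"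
    and \<Phi>_boundary: "(j, C, v) \<in> topspace (equivariant_cells G n m H) \<Longrightarrow> v \<in> boundary_sphere n \<Longrightarrow>
      \<Phi> (j, C, v) \<in> A"
    and \<Phi>_bij: "bij_betw \<Phi>
      {(j, C, v). (j, C, v) \<in> topspace (equivariant_cells G n m H) \<and> v \<notin> boundary_sphere n} (B - A)"
    and final_topology: "U \<subseteq> B \<Longrightarrow> openin (subtopology X B) U \<longleftrightarrow>
      openin (subtopology X A) (U \<inter> A) \<and>
      openin (equivariant_cells G n m H) {z \<in> topspace (equivariant_cells G n m H). \<Phi> z \<in> U}"
begin

definition cells :: "(nat \<times> 'g set \<times> (nat \<Rightarrow> real)) set" where
  "cells = topspace (equivariant_cells G n m H)"

definition inner :: "(nat \<times> 'g set \<times> (nat \<Rightarrow> real)) set" where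
  "inner = {(j, C, v). (j, C, v) \<in> cells \<and> v \<notin> boundary_sphere n}"

lemma cells_iff: "(j, C, v) \<in> cells \<longleftrightarrow> j < m \<and> C \<in> lcosets\<^bsub>G\<^esub> (H j) \<and> v \<in> topspace (unit_disk n)"
  by (auto simp: cells_def equivariant_cells_def)

lemma inner_iff: "(j, C, v) \<in> inner \<longleftrightarrow> (j, C, v) \<in> cells \<and> sqn n v < 1"
  by (auto simp: inner_def cells_iff boundary_sphere_iff topspace_unit_disk)

lemma boundary_cells: "(j, C, v) \<in> cells \<Longrightarrow> sqn n v = 1 \<Longrightarrow> \<Phi> (j, C, v) \<in> A"
  by (rule \<Phi>_boundary) (auto simp: cells_iff boundary_sphere_iff topspace_unit_disk simp flip: cells_def)

lemma bij: "bij_betw \<Phi> inner (B - A)"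
  using \<Phi>_bij by (simp add: inner_def cells_def)

lemma inner_\<Phi>: "e \<in> inner \<Longrightarrow> \<Phi> e \<in> B - A"
  using bij by (auto simp: bij_betw_def)

lemma \<Phi>_inj: "e \<in> inner \<Longrightarrow> e' \<in> inner \<Longrightarrow> \<Phi> e = \<Phi> e' \<Longrightarrow> e = e'"
  using bij by (auto simp: bij_betw_def dest: inj_onD)

lemma B_cases:
  assumes "x \<in> B"
  obtains "x \<in> A" | j C v where "x = \<Phi> (j, C, v)" "(j, C, v) \<in> inner"
  using assms bij by (fastforce simp: bij_betw_def image_iff)

lemma radial_cells: "(j, C, v) \<in> cells \<Longrightarrow> sqn n v > 0 \<Longrightarrow> (j, C, radial n v) \<in> cells"
  using radial_in_boundary[of v n] by (auto simp: cells_iff boundary_sphere_def)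

lemma radial_A: "(j, C, v) \<in> cells \<Longrightarrow> sqn n v > 0 \<Longrightarrow> \<Phi> (j, C, radial n v) \<in> A"
  using radial_cells[of j C v] radial_in_boundary[of v n]
  by (intro \<Phi>_boundary) (auto simp: cells_iff simp flip: cells_def)

sublocale act: group_action G "topspace X" \<phi>
  using G_space by (simp add: G_space_def)

sublocale grp: group G
  using act.group_hom by (simp add: group_hom_def)

lemma coset_translate: "j < m \<Longrightarrow> C \<in> lcosets\<^bsub>G\<^esub> (H j) \<Longrightarrow> g \<in> carrier G \<Longrightarrow> g <#\<^bsub>G\<^esub> C \<in> lcosets\<^bsub>G\<^esub> (H j)"
  using grp.lcos_m_assoc[OF subgroup.subset[OF H]] by (fastforce simp: LCOSETS_def)

lemma cells_translate: "(j, C, v) \<in> cells \<Longrightarrow> g \<in> carrier G \<Longrightarrow> (j, g <#\<^bsub>G\<^esub> C, v) \<in> cells"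
  by (auto simp: cells_iff coset_translate)

lemma inner_translate: "(j, C, v) \<in> inner \<Longrightarrow> g \<in> carrier G \<Longrightarrow> (j, g <#\<^bsub>G\<^esub> C, v) \<in> inner"
  by (simp add: inner_iff cells_translate)

lemma \<phi>_\<Phi>: "(j, C, v) \<in> cells \<Longrightarrow> g \<in> carrier G \<Longrightarrow> \<phi> g (\<Phi> (j, C, v)) = \<Phi> (j, g <#\<^bsub>G\<^esub> C, v)"
  by (simp add: \<Phi>_equivariant cells_def)

definition centers :: "'x set" where
  "centers = {\<Phi> (j, C, \<lambda>_. 0) | j C. j < m \<and> C \<in> lcosets\<^bsub>G\<^esub> (H j)}"

lemma center_inner: "j < m \<Longrightarrow> C \<in> lcosets\<^bsub>G\<^esub> (H j) \<Longrightarrow> (j, C, \<lambda>_. 0) \<in> inner"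
  by (simp add: inner_iff cells_iff topspace_unit_disk)

lemma centers_sub: "centers \<subseteq> B - A"
  using inner_\<Phi> center_inner by (auto simp: centers_def)

lemma finite_centers: "finite centers"
proof -
  have "finite (lcosets\<^bsub>G\<^esub> (H j))" for j
    using finite_G by (simp add: LCOSETS_def)
  then have "finite (\<Union>j\<in>{..<m}. (\<lambda>C. \<Phi> (j, C, \<lambda>_. 0)) ` (lcosets\<^bsub>G\<^esub> (H j)))"
    by simp
  moreover have "centers = (\<Union>j\<in>{..<m}. (\<lambda>C. \<Phi> (j, C, \<lambda>_. 0)) ` (lcosets\<^bsub>G\<^esub> (H j)))"
    by (auto simp: centers_def)
  ultimately show ?thesis
    by simp
qed

definition d' :: "'x \<Rightarrow> nat" where
  "d' z = (if z \<in> A then d z else n)"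

text \<open>The factor \<open>max 0 (2 * sqn n v - 1)\<close> vanishes near the centre, where \<open>radial\<close> is not continuous.\<close>

definition cell_weight :: "'x \<Rightarrow> nat \<times> 'g set \<times> (nat \<Rightarrow> real) \<Rightarrow> real" where
  "cell_weight z = (\<lambda>(j, C, v).
     if z \<in> A then max 0 (2 * sqn n v - 1) * w z (\<Phi> (j, C, radial n v))
     else if z = \<Phi> (j, C, \<lambda>_. 0) then 1 - sqn n v else 0)"

definition w' :: "'x \<Rightarrow> 'x \<Rightarrow> real" where
  "w' z x =
     (if x \<in> A then (if z \<in> A then w z x else 0) else cell_weight z (the_inv_into inner \<Phi> x))"

text \<open>The two branches of \<open>w'\<close> fit together on the boundary sphere: there
  \<open>radial\<close> is the identity, the factor of the old weights is 1, and the weight 1 - sqn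
  n v of the centre vanishes.\<close>

lemma w'_\<Phi>:
  assumes "(j, C, v) \<in> cells"
  shows "w' z (\<Phi> (j, C, v)) = cell_weight z (j, C, v)"
proof (cases "sqn n v < 1")
  case True
  then have "(j, C, v) \<in> inner"
    using assms by (simp add: inner_iff)
  then show ?thesis
    using inner_\<Phi> bij by (auto simp: w'_def bij_betw_def the_inv_into_f_f)
next
  case False
  then have v: "sqn n v = 1" "v \<in> boundary_sphere n"
    using assms by (auto simp: cells_iff topspace_unit_disk boundary_sphere_iff)
  then show ?thesis
    using boundary_cells[OF assms] by (simp add: w'_def cell_weight_def radial_boundary)
qed

lemma slice_cont:
  assumes "j < m" "C \<in> lcosets\<^bsub>G\<^esub> (H j)"
  shows "continuous_map (unit_disk n) (subtopology X B) (\<lambda>v. \<Phi> (j, C, v))"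
proof -
  have "continuous_map (unit_disk n) (prod_topology (discrete_topology (lcosets\<^bsub>G\<^esub> (H j))) (unit_disk n)) (\<lambda>v. (C, v))"
    using assms by (intro continuous_map_pairedI) (auto simp: continuous_map_id[unfolded id_def])
  moreover have "continuous_map (prod_topology (discrete_topology (lcosets\<^bsub>G\<^esub> (H j))) (unit_disk n))
      (equivariant_cells G n m H) (\<lambda>x. (j, x))"
    unfolding equivariant_cells_def using assms continuous_map_component_injection[of j "{..<m}"] by fastforce
  ultimately have "continuous_map (unit_disk n) (equivariant_cells G n m H) (\<lambda>v. (j, C, v))"
    using continuous_map_compose[of _ _ "\<lambda>v. (C, v)" _ "\<lambda>x. (j, x)"] by (simp add: o_def)
  from continuous_map_compose[OF this \<Phi>_cont] show ?thesis
    by (simp add: o_def)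
qed

lemma cell_weight_cont:
  assumes "z \<in> Z \<union> centers"
  shows "continuous_map (equivariant_cells G n m H) euclideanreal (cell_weight z)"
  unfolding equivariant_cells_def
proof (intro continuous_map_from_sum_topology continuous_map_from_discrete_prod)
  fix j C assume j: "j \<in> {..<m}" and C: "C \<in> lcosets\<^bsub>G\<^esub> (H j)"
  have sq: "continuous_map (unit_disk n) euclideanreal (sqn n)"
    by (simp add: unit_disk_eq continuous_sqn)
  show "continuous_map (unit_disk n) euclideanreal (\<lambda>v. cell_weight z (j, C, v))"
  proof (cases "z \<in> A")
    case True
    then have z: "z \<in> Z"
      using assms centers_sub by blast
    have "continuous_map (subtopology (unit_disk n) (boundary_sphere n)) (subtopology X A) (\<lambda>v. \<Phi> (j, C, v))"
    proof -
      have "continuous_map (subtopology (unit_disk n) (boundary_sphere n)) X (\<lambda>v. \<Phi> (j, C, v))"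
        using slice_cont[of j C] j C by (auto simp: continuous_map_in_subtopology intro: continuous_map_from_subtopology)
      then show ?thesis
        using boundary_cells j C
        by (auto simp: continuous_map_in_subtopology cells_iff boundary_sphere_iff)
    qed
    from continuous_map_compose[OF this w_cont[OF z]]
    have "continuous_map (subtopology (unit_disk n) (boundary_sphere n)) euclideanreal (\<lambda>v. w z (\<Phi> (j, C, v)))"
      by (simp add: o_def)
    from continuous_radial_extension[OF this] True show ?thesis
      by (simp add: cell_weight_def)
  next
    case False
    then show ?thesis
      using sq by (cases "z = \<Phi> (j, C, \<lambda>_. 0)") (auto simp: cell_weight_def intro: continuous_map_diff)
  qed
qed

text \<open>In the pushout topology openness of a preimage is tested on \<open>A\<close>, where the
  old weights are continuous, and on the cells, where \<open>cell_weight\<close> describes the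
  function.\<close>

lemma w'_cont:
  assumes z: "z \<in> Z \<union> centers"
  shows "continuous_map (subtopology X B) euclideanreal (w' z)"
  unfolding continuous_map_def
proof (intro conjI allI impI)
  fix U assume U: "openin euclideanreal U"
  have "continuous_map (subtopology X A) euclideanreal (\<lambda>x. if z \<in> A then w z x else 0)"
    using z centers_sub w_cont[of z] by (cases "z \<in> A") auto
  from openin_continuous_map_preimage[OF this U]
  have "openin (subtopology X A) {x \<in> A. (if z \<in> A then w z x else 0) \<in> U}"
    using A_sub by (simp only: topspace_subtopology_subset)
  moreover have "{x \<in> A. (if z \<in> A then w z x else 0) \<in> U} = {x \<in> B. w' z x \<in> U} \<inter> A"
    using A_B by (auto simp: w'_def)
  moreover have "{e \<in> cells. \<Phi> e \<in> {x \<in> B. w' z x \<in> U}} = {e \<in> cells. cell_weight z e \<in> U}"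
    using \<Phi>_cont w'_\<Phi> B_sub by (fastforce simp: continuous_map_def cells_def[symmetric])
  moreover have "openin (equivariant_cells G n m H) {e \<in> cells. cell_weight z e \<in> U}"
    using cell_weight_cont[OF z] U by (simp add: continuous_map_def cells_def)
  ultimately have "openin (subtopology X B) {x \<in> B. w' z x \<in> U}"
    by (subst final_topology) (auto simp: cells_def)
  then show "openin (subtopology X B) {x \<in> topspace (subtopology X B). w' z x \<in> U}"
    using B_sub by (simp add: Int_absorb1)
qed simp

text \<open>If \<open>g\<close> fixes the centre, injectivity on open cells gives gC = C, so
  \<open>g\<close> fixes every point of this cell. For \<open>g\<close> other than the identity a
  segment of the cell would be a connected part of the discrete set of points with non-trivial
  stabilizer, hence one point, against injectivity.\<close>

lemma center_free:
  assumes j: "j < m" "C \<in> lcosets\<^bsub>G\<^esub> (H j)" and n: "0 < n"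
    and g: "g \<in> carrier G" "\<phi> g (\<Phi> (j, C, \<lambda>_. 0)) = \<Phi> (j, C, \<lambda>_. 0)"
  shows "g = \<one>\<^bsub>G\<^esub>"
proof (rule ccontr)
  assume ne: "g \<noteq> \<one>\<^bsub>G\<^esub>"
  define S where "S = {x \<in> topspace X. stabilizer G \<phi> x \<noteq> {\<one>\<^bsub>G\<^esub>}}"
  have S: "subtopology X S = discrete_topology S"
    using pseudofree by (simp add: pseudofree_def S_def Let_def)
  have "\<Phi> (j, g <#\<^bsub>G\<^esub> C, \<lambda>_. 0) = \<Phi> (j, C, \<lambda>_. 0)"
    using g \<phi>_\<Phi> center_inner[OF j] by (simp add: inner_iff)
  then have gC: "g <#\<^bsub>G\<^esub> C = C"
    using \<Phi>_inj inner_translate[OF center_inner[OF j] g(1)] center_inner[OF j] by blast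
  \<comment> \<open>Coordinate 0 exists because n > 0, and t up to 1/2 keeps the segment inside the
    open cell.\<close>
  define \<gamma> :: "real \<Rightarrow> nat \<Rightarrow> real" where "\<gamma> t = (\<lambda>i. if i = 0 then t else 0)" for t
  have sq: "sqn n (\<gamma> t) = t\<^sup>2" for t
    using n by (simp add: sqn_def \<gamma>_def if_distrib[of "\<lambda>x. x\<^sup>2"] cong: if_cong)
  have \<gamma>: "(j, C, \<gamma> t) \<in> inner" if "t \<in> {0..1/2}" for t
  proof -
    have "t\<^sup>2 \<le> (1/2)\<^sup>2"
      using that by (intro power_mono) auto
    then show ?thesis
      using n j by (auto simp: inner_iff cells_iff topspace_unit_disk sq power2_eq_square) (simp add: \<gamma>_def)
  qed
  have fixed: "\<Phi> (j, C, \<gamma> t) \<in> S" if "t \<in> {0..1/2}" for t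
  proof -
    have "\<phi> g (\<Phi> (j, C, \<gamma> t)) = \<Phi> (j, C, \<gamma> t)"
      using \<phi>_\<Phi> \<gamma>[OF that] g(1) gC by (simp add: inner_iff)
    then show ?thesis
      using inner_\<Phi>[OF \<gamma>[OF that]] B_sub ne g(1) by (auto simp: S_def stabilizer_def)
  qed
  have "continuous_map (top_of_set {0..1/2}) (unit_disk n) \<gamma>"
  proof -
    have "continuous_on {0..1/2} \<gamma>"
    proof (rule continuous_on_coordinatewise_then_product)
      show "continuous_on {0..1/2} (\<lambda>t. \<gamma> t i)" for i
        by (cases "i = 0") (auto simp: \<gamma>_def)
    qed
    moreover have "\<gamma> t \<in> topspace (unit_disk n)" if "t \<in> {0..1/2}" for t
      using \<gamma>[OF that] by (simp add: inner_iff cells_iff)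
    ultimately show ?thesis
      unfolding unit_disk_eq by (auto simp: continuous_map_in_subtopology topspace_unit_disk[unfolded unit_disk_eq])
  qed
  from continuous_map_compose[OF this slice_cont[OF j]]
  have "continuous_map (top_of_set {0..1/2}) (subtopology X S) (\<lambda>t. \<Phi> (j, C, \<gamma> t))"
    using fixed by (auto simp: continuous_map_in_subtopology o_def)
  then have "connectedin (discrete_topology S) ((\<lambda>t. \<Phi> (j, C, \<gamma> t)) ` {0..1/2})"
    unfolding S by (rule connectedin_continuous_map_image) (simp add: connectedin_subtopology)
  then obtain a where a: "(\<lambda>t. \<Phi> (j, C, \<gamma> t)) ` {0..1/2} \<subseteq> {a}"
    unfolding connectedin_discrete_topology by blast
  have "\<Phi> (j, C, \<gamma> t) = a" if "t \<in> {0..1/2}" for t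
    using a that by blast
  from this[of 0] this[of "1/2"] have "\<Phi> (j, C, \<gamma> 0) = \<Phi> (j, C, \<gamma> (1/2))"
    by simp
  then have "\<gamma> 0 = \<gamma> (1/2)"
    using \<Phi>_inj[OF \<gamma> \<gamma>, of 0 "1/2"] by simp
  from fun_cong[OF this, of 0] show False
    by (simp add: \<gamma>_def)
qed

text \<open>A point of an open cell has positive weight 1 - sqn n v at the centre of its cell and
  weight 0 at all other new centres. Old and new centres never have the same \<open>d'\<close>, and
  orthogonality of old weights is inherited through the radial projection to
  \<open>A\<close>.\<close>

lemma attached: "cell_weights G X \<phi> (Suc n) B (Z \<union> centers) d' w'"
proof
  have Z_A: "z \<in> A \<longleftrightarrow> z \<in> Z" if "z \<in> Z \<union> centers" for z
    using that Z_sub centers_sub by blast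
  show "finite (Z \<union> centers)"
    by (simp add: finite_Z finite_centers)
  show "Z \<union> centers \<subseteq> B"
    using Z_sub A_B centers_sub by blast
  show "B \<subseteq> topspace X"
    by (rule B_sub)
  show "d' z < Suc n" if "z \<in> Z \<union> centers" for z
    using that Z_A[OF that] d_less[of z] by (auto simp: d'_def)
  have ctr: "\<phi> g z \<in> centers" if "g \<in> carrier G" "z \<in> centers" for g z
    using that \<phi>_\<Phi> coset_translate center_inner by (fastforce simp: centers_def inner_iff)
  show closed: "\<phi> g z \<in> Z \<union> centers" if "g \<in> carrier G" "z \<in> Z \<union> centers" for g z
    using that ctr Z_closed by blast
  have A_iff: "\<phi> g z \<in> A \<longleftrightarrow> z \<in> A" if "g \<in> carrier G" "z \<in> Z \<union> centers" for g z
    using that ctr[of g z] Z_closed[of g z] Z_sub centers_sub by blast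
  show "d' (\<phi> g z) = d' z" if "g \<in> carrier G" "z \<in> Z \<union> centers" for g z
    using that A_iff Z_A d_invariant by (auto simp: d'_def)
  have B_inner: "\<phi> g (\<Phi> e) \<in> B - A" if "g \<in> carrier G" "e \<in> inner" for g e
    using that \<phi>_\<Phi> inner_translate inner_\<Phi> by (cases e) (metis inner_iff)
  show "\<phi> g x \<in> B" if "g \<in> carrier G" "x \<in> B" for g x
    using that(2) by (cases rule: B_cases) (use that B_inner A_closed A_B in auto)
  show "continuous_map (subtopology X B) euclideanreal (w' z)" if "z \<in> Z \<union> centers" for z
    by (rule w'_cont[OF that])
  show "0 \<le> w' z x" if "x \<in> B" "z \<in> Z \<union> centers" for x z
    using that(1)
  proof (cases rule: B_cases)
    case 1
    then show ?thesis
      using Z_A[OF that(2)] w_nonneg by (simp add: w'_def)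
  next
    case (2 j C v)
    have "0 \<le> max 0 (2 * sqn n v - 1) * w z (\<Phi> (j, C, radial n v))" if "z \<in> Z"
    proof (cases "1 / 2 < sqn n v")
      case True
      then have "0 \<le> w z (\<Phi> (j, C, radial n v))"
        using 2 radial_A[of j C v] w_nonneg that by (auto simp: inner_iff)
      then show ?thesis
        by simp
    qed (simp add: max_absorb1)
    then show ?thesis
      using 2 w'_\<Phi>[of j C v z] Z_A[OF that(2)] by (auto simp: cell_weight_def inner_iff)
  qed
  show "\<exists>z\<in>Z \<union> centers. 0 < w' z x" if "x \<in> B" for x
    using that
  proof (cases rule: B_cases)
    case 1
    then show ?thesis
      using w_pos[of x] Z_sub by (auto simp: w'_def)
  next
    case (2 j C v)
    then have "\<Phi> (j, C, \<lambda>_. 0) \<in> centers"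
      by (auto simp: centers_def inner_iff cells_iff)
    moreover have "0 < w' (\<Phi> (j, C, \<lambda>_. 0)) x"
      using 2 w'_\<Phi>[of j C v] centers_sub calculation by (auto simp: cell_weight_def inner_iff)
    ultimately show ?thesis
      by blast
  qed
  show "w' z x * w' z' x = 0"
    if x: "x \<in> B" and z: "z \<in> Z \<union> centers" "z' \<in> Z \<union> centers" and "d' z = d' z'" "z \<noteq> z'" for x z z'
  proof -
    have A: "z \<in> A \<longleftrightarrow> z' \<in> A"
      using that d_less Z_A by (auto simp: d'_def split: if_splits)
    have orth: "w z y * w z' y = 0" if "y \<in> A" "z \<in> A" for y
    proof (rule w_orthogonal)
      show "z \<in> Z" "z' \<in> Z"
        using A Z_A z that(2) by blast+
      show "d z = d z'"
        using A that(2) \<open>d' z = d' z'\<close> by (simp add: d'_def)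
    qed fact+
    show ?thesis
      using x
    proof (cases rule: B_cases)
      case 1
      then show ?thesis
        using orth[of x] by (simp add: w'_def)
    next
      case (2 j C v)
      have "cell_weight z (j, C, v) * cell_weight z' (j, C, v) = 0"
      proof (cases "z \<in> A \<and> 1 / 2 < sqn n v")
        case True
        then have "w z (\<Phi> (j, C, radial n v)) * w z' (\<Phi> (j, C, radial n v)) = 0"
          using 2(2) radial_A[of j C v] by (intro orth) (auto simp: inner_iff)
        then show ?thesis
          using True A by (auto simp: cell_weight_def)
      next
        case False
        then show ?thesis
          using A \<open>z \<noteq> z'\<close> by (auto simp: cell_weight_def max_absorb1)
      qed
      then show ?thesis
        using 2 by (simp add: w'_\<Phi> inner_iff)
    qed
  qed
  show "w' (\<phi> g z) (\<phi> g x) = w' z x" if g: "g \<in> carrier G" and "x \<in> B" and z: "z \<in> Z \<union> centers" for g x z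
    using \<open>x \<in> B\<close>
  proof (cases rule: B_cases)
    case 1
    then show ?thesis
      using g z A_iff A_closed Z_A w_equivariant by (auto simp: w'_def)
  next
    case (2 j C v)
    have cell: "(j, C, v) \<in> cells" "(j, g <#\<^bsub>G\<^esub> C, v) \<in> cells"
      using 2 g cells_translate by (auto simp: inner_iff)
    have "w (\<phi> g z) (\<Phi> (j, g <#\<^bsub>G\<^esub> C, radial n v)) = w z (\<Phi> (j, C, radial n v))"
      if "1 / 2 < sqn n v" "z \<in> Z"
      using w_equivariant[OF g radial_A[OF cell(1)] that(2)] that \<phi>_\<Phi>[OF radial_cells[OF cell(1)] g] by simp
    moreover have "\<phi> g z = \<Phi> (j, g <#\<^bsub>G\<^esub> C, \<lambda>_. 0) \<longleftrightarrow> z = \<Phi> (j, C, \<lambda>_. 0)"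
    proof -
      have c: "(j, C, \<lambda>_. 0) \<in> inner"
        using cell by (intro center_inner) (auto simp: cells_iff)
      then have "\<phi> g (\<Phi> (j, C, \<lambda>_. 0)) = \<Phi> (j, g <#\<^bsub>G\<^esub> C, \<lambda>_. 0)"
        using \<phi>_\<Phi> g by (simp add: inner_iff)
      moreover have "z \<in> topspace X" "\<Phi> (j, C, \<lambda>_. 0) \<in> topspace X"
        using z Z_sub A_sub centers_sub B_sub inner_\<Phi>[OF c] by auto
      ultimately show ?thesis
        using act.inj_prop[OF g] by (metis inj_onD)
    qed
    ultimately have "cell_weight (\<phi> g z) (j, g <#\<^bsub>G\<^esub> C, v) = cell_weight z (j, C, v)"
      using A_iff[OF g z] Z_A[OF z]
      by (cases "1 / 2 < sqn n v") (auto simp: cell_weight_def max_absorb1)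
    then show ?thesis
      using 2 cell g by (simp add: \<phi>_\<Phi> w'_\<Phi>)
  qed
  show "g = \<one>\<^bsub>G\<^esub>" if "g \<in> carrier G" "z \<in> Z \<union> centers" "0 < d' z" "\<phi> g z = z" for g z
  proof (cases "z \<in> A")
    case True
    then show ?thesis
      using that Z_A Z_free by (auto simp: d'_def)
  next
    case False
    then show ?thesis
      using that Z_sub center_free by (auto simp: d'_def centers_def)
  qed
qed

end

lemma cell_weights_attach:
  assumes "cell_weights G X \<phi> n A Z d w" "attach_equivariant_cells G X \<phi> n A B"
    and "G_space G X \<phi>" "finite (carrier G)" "pseudofree G X \<phi>"
  shows "\<exists>Z d w. cell_weights G X \<phi> (Suc n) B Z d w"
proof -
  obtain m H \<Phi> where att: "A \<subseteq> B" "B \<subseteq> topspace X" "\<forall>j<m. subgroup (H j) G"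
    "continuous_map (equivariant_cells G n m H) (subtopology X B) \<Phi>"
    "\<forall>(j, C, v) \<in> topspace (equivariant_cells G n m H). \<forall>g\<in>carrier G.
       \<Phi> (j, g <#\<^bsub>G\<^esub> C, v) = \<phi> g (\<Phi> (j, C, v))"
    "\<forall>(j, C, v) \<in> topspace (equivariant_cells G n m H). v \<in> boundary_sphere n \<longrightarrow> \<Phi> (j, C, v) \<in> A"
    "bij_betw \<Phi>
      {(j, C, v). (j, C, v) \<in> topspace (equivariant_cells G n m H) \<and> v \<notin> boundary_sphere n} (B - A)"
    "\<forall>U\<subseteq>B. openin (subtopology X B) U \<longleftrightarrow>
       openin (subtopology X A) (U \<inter> A) \<and>
       openin (equivariant_cells G n m H) {z \<in> topspace (equivariant_cells G n m H). \<Phi> z \<in> U}"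
    using assms(2) unfolding attach_equivariant_cells_def by (elim conjE exE) (rule that)
  have "cell_attachment G X \<phi> n A Z d w B m H \<Phi>"
  proof (intro cell_attachment.intro cell_attachment_axioms.intro)
    show "subgroup (H j) G" if "j < m" for j
      using att(3) that by blast
    show "\<Phi> (j, g <#\<^bsub>G\<^esub> C, v) = \<phi> g (\<Phi> (j, C, v))"
      if "(j, C, v) \<in> topspace (equivariant_cells G n m H)" "g \<in> carrier G" for j C v g
      using bspec[OF att(5) that(1)] that(2) by simp
    show "\<Phi> (j, C, v) \<in> A"
      if "(j, C, v) \<in> topspace (equivariant_cells G n m H)" "v \<in> boundary_sphere n" for j C v
      using bspec[OF att(6) that(1)] that(2) by simp
    show "openin (subtopology X B) U \<longleftrightarrow> openin (subtopology X A) (U \<inter> A) \<and>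
       openin (equivariant_cells G n m H) {z \<in> topspace (equivariant_cells G n m H). \<Phi> z \<in> U}"
      if "U \<subseteq> B" for U
      using att(8) that by blast
  qed fact+
  then show ?thesis
    using cell_attachment.attached by blast
qed

lemma finite_G_CW_complex_weights:
  assumes "finite_G_CW_complex G X \<phi>" "finite (carrier G)" "pseudofree G X \<phi>"
  shows "\<exists>n Z d w. cell_weights G X \<phi> n (topspace X) Z d w"
proof -
  obtain N sk where G: "G_space G X \<phi>" and sk: "sk 0 = {}" "sk N = topspace X"
    "\<And>n. n < N \<Longrightarrow> attach_equivariant_cells G X \<phi> n (sk n) (sk (Suc n))"
    using assms(1) by (auto simp: finite_G_CW_complex_def)
  have "n \<le> N \<Longrightarrow> \<exists>Z d w. cell_weights G X \<phi> n (sk n) Z d w" for n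
  proof (induction n)
    case 0
    then show ?case
      using cell_weights_empty sk(1) by metis
  next
    case (Suc n)
    then show ?case
      using cell_weights_attach[OF _ sk(3) G assms(2,3)] by (meson Suc_le_lessD less_imp_le)
  qed
  then show ?thesis
    using sk(2) by (metis order_refl)
qed

section \<open>Homology of homotopy spheres\<close>

lemma trivial_group_class_boundary:
  assumes "trivial_group (homology_group (int n) X)" "singular_relcycle n X {} c"
  shows "\<exists>e. singular_chain (Suc n) X e \<and> chain_boundary (Suc n) e = c"
proof -
  have "homologous_rel_set n X {} c \<in> carrier (homology_group (int n) X)"
    using assms(2) by (auto simp: carrier_relative_homology_group)
  then have "homologous_rel_set n X {} c = singular_relboundary_set n X {}"
    using assms(1) by (auto simp: trivial_group_def)
  then show ?thesis
    by (simp add: homologous_rel_set_eq_relboundary singular_boundary)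
qed

context
  fixes X :: "'x topology" and K :: nat
  assumes sphere: "X homotopy_equivalent_space nsphere K"
begin

lemma trivial_reduced_homology_sphere: "p \<noteq> int K \<Longrightarrow> trivial_group (reduced_homology_group p X)"
  using isomorphic_group_triviality[OF homotopy_equivalent_space_imp_isomorphic_reduced_homology_groups[OF sphere]]
    reduced_homology_group_nsphere(2) by auto

lemma sphere_nonempty: "topspace X \<noteq> {}"
proof
  assume "topspace X = {}"
  then have "trivial_group (reduced_homology_group (int K) X)"
    by (rule trivial_reduced_homology_group_empty)
  then show False
    using isomorphic_group_triviality[OF homotopy_equivalent_space_imp_isomorphic_reduced_homology_groups[OF sphere]]
      trivial_reduced_homology_group_nsphere by auto
qed

lemma sphere_cycle_boundary:
  assumes "singular_chain (Suc n) X c" "chain_boundary (Suc n) c = 0" "Suc n \<noteq> K"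
  shows "\<exists>e. singular_chain (Suc (Suc n)) X e \<and> chain_boundary (Suc (Suc n)) e = c"
proof (rule trivial_group_class_boundary)
  show "trivial_group (homology_group (int (Suc n)) X)"
    using trivial_reduced_homology_sphere[of "int (Suc n)"] assms(3) un_reduced_homology_group[of "int (Suc n)" X] by simp
  show "singular_relcycle (Suc n) X {} c"
    using assms by (simp add: singular_cycle)
qed

text \<open>Under an isomorphism of the homology in degree \<open>K\<close> with the integers, the
  class of \<open>c\<close> becomes an integer whose p-fold multiple is 0.\<close>

lemma sphere_torsion_free:
  assumes c: "singular_chain K X c" "chain_boundary K c = 0" and "0 < K" "0 < p"
    and "singular_relboundary K X {} (\<Sum>i<(p::nat). c)"
  shows "singular_relboundary K X {} c"
proof -
  let ?H = "homology_group (int K) X"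
  have "?H \<cong> integer_group"
    using homotopy_equivalent_space_imp_isomorphic_reduced_homology_groups[OF sphere, of "int K"]
      reduced_homology_group_nsphere(1)[of K] un_reduced_homology_group[of "int K" X] assms(3) iso_trans by force
  then obtain f where f: "f \<in> iso ?H integer_group"
    by (auto simp: is_iso_def)
  define h where "h e = f (homologous_rel_set K X {} e)" for e
  have "(\<lambda>e. homologous_rel_set K X {} e) \<in> hom (relcycle_group K X {}) ?H"
    using normal.r_coset_hom_Mod[OF normal_subgroup_singular_relboundary_relcycle[of K X "{}"]]
    by (simp add: right_coset_singular_relboundary nontrivial_relative_homology_group)
  then have hom: "f \<circ> homologous_rel_set K X {} \<in> hom (relcycle_group K X {}) integer_group"
    using f by (intro hom_compose) (auto simp: iso_def)
  have h_add: "h (e + e') = h e + h e'" if "singular_relcycle K X {} e" "singular_relcycle K X {} e'" for e e'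
    using hom_mult[OF hom, of e e'] that by (simp add: h_def)
  have cyc: "singular_relcycle K X {} c"
    using c by (simp add: singular_cycle)
  have h_0: "h 0 = 0"
    using h_add[of 0 0] by simp
  have "h (\<Sum>i<q. c) = int q * h c" for q
  proof (induction q)
    case (Suc q)
    have "singular_relcycle K X {} (\<Sum>i<q. c)"
      using cyc by (intro singular_relcycle_sum)
    then show ?case
      using Suc cyc by (simp add: h_add algebra_simps)
  qed (simp add: h_0)
  moreover have "homologous_rel_set K X {} (\<Sum>i<p. c) = homologous_rel_set K X {} 0"
    using iffD2[OF homologous_rel_set_eq_relboundary assms(5)]
      iffD2[OF homologous_rel_set_eq_relboundary singular_relboundary_0[of K X "{}"]] by (rule trans[OF _ sym])
  then have "h (\<Sum>i<p. c) = h 0"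
    by (simp add: h_def)
  ultimately have "h c = h 0"
    using h_0 \<open>0 < p\<close> by simp
  then have "homologous_rel_set K X {} c = homologous_rel_set K X {} 0"
    using f cyc unfolding h_def
    by (auto simp: iso_def bij_betw_def carrier_relative_homology_group dest!: inj_onD)
  then show ?thesis
    using iffD2[OF homologous_rel_set_eq_relboundary singular_relboundary_0[of K X "{}"]]
    by (intro iffD1[OF homologous_rel_set_eq_relboundary]) (rule trans)
qed

text \<open>Vanishing of the image of \<open>u\<close> in a point puts its class into the kernel
  defining reduced homology, which is trivial in degree 0 as K > 0.\<close>

lemma sphere_points_homologous:
  assumes "0 < K" "singular_chain 0 X u" "chain_map 0 (\<lambda>_. ()) u = 0"
  shows "\<exists>c. singular_chain 1 X c \<and> chain_boundary 1 c = u"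
proof -
  let ?R = "reduced_homology_group 0 X" and ?H = "homology_group 0 X"
  have cyc: "singular_relcycle 0 X {} u"
    using assms(2) by (simp add: singular_cycle chain_boundary_def)
  let ?u = "homologous_rel_set 0 X {} u"
  have u: "?u \<in> carrier ?H"
    using cyc by (auto simp: carrier_relative_homology_group_0)
  have "hom_induced (int 0) X {} (discrete_topology {()}) {} (\<lambda>_. ()) ?u =
      homologous_rel_set 0 (discrete_topology {()}) {} 0"
    using hom_induced_chain_map[OF _ _ cyc, of "discrete_topology {()}" "\<lambda>_. ()" "{}"] assms(3) by simp
  also have "\<dots> = \<one>\<^bsub>homology_group (int 0) (discrete_topology {()})\<^esub>"
    unfolding one_relative_homology_group by (subst homologous_rel_set_eq_relboundary) simp
  finally have "?u \<in> carrier ?R"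
    using u by (auto simp: reduced_homology_group_def carrier_subgroup_generated kernel_def intro!: generate.incl)
  moreover have "\<one>\<^bsub>?R\<^esub> = singular_relboundary_set 0 X {}"
    using one_relative_homology_group[of 0 X "{}"] by (simp add: reduced_homology_group_def)
  ultimately have "?u = singular_relboundary_set 0 X {}"
    using trivial_reduced_homology_sphere[of 0] assms(1) by (auto simp: trivial_group_def)
  then show ?thesis
    by (simp add: homologous_rel_set_eq_relboundary singular_boundary)
qed

end

lemma trivial_on_homology_boundary:
  assumes "trivial_on_homology G X \<phi>" "G_space G X \<phi>" "g \<in> carrier G"
    and "singular_chain n X c" "chain_boundary n c = 0"
  shows "\<exists>e. singular_chain (Suc n) X e \<and> chain_boundary (Suc n) e = chain_map n (\<phi> g) c - c"
proof -
  have cyc: "singular_relcycle n X {} c"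
    using assms by (simp add: singular_cycle)
  have "homologous_rel_set n X {} c \<in> carrier (homology_group (int n) X)"
    using cyc by (auto simp: carrier_relative_homology_group)
  then have "hom_induced (int n) X {} X {} (\<phi> g) (homologous_rel_set n X {} c) = homologous_rel_set n X {} c"
    by (rule assms(1)[unfolded trivial_on_homology_def, rule_format, OF assms(3)])
  moreover have "continuous_map X X (\<phi> g)"
    using assms(2,3) by (simp add: G_space_def)
  ultimately have "homologous_rel_set n X {} (chain_map n (\<phi> g) c) = homologous_rel_set n X {} c"
    using hom_induced_chain_map[of X X "\<phi> g" "{}" "{}" n c] cyc by simp
  then have "homologous_rel n X {} (chain_map n (\<phi> g) c) c"
    using homologous_rel_refl[of n X "{}" c] by blast
  then have "singular_relboundary n X {} (chain_map n (\<phi> g) c - c)"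
    by (simp add: homologous_rel_def)
  then show ?thesis
    by (simp add: singular_boundary)
qed

section \<open>Labelling points by cell centres\<close>

context cell_weights
begin

definition maximizers :: "'x \<Rightarrow> 'x set" where
  "maximizers x = {z \<in> Z. \<forall>z'\<in>Z. w z' x \<le> w z x}"

text \<open>Ties are broken by the least \<open>d\<close>. This is invariant under the group, so
  that labelling is equivariant, and determines the label because maximizers have different values
  of \<open>d\<close>.\<close>

definition label :: "'x \<Rightarrow> 'x" where
  "label x = (THE z. z \<in> maximizers x \<and> (\<forall>z'\<in>maximizers x. d z \<le> d z'))"

lemma maximizers_nonempty: "x \<in> A \<Longrightarrow> maximizers x \<noteq> {}"
proof -
  assume "x \<in> A"
  then have "Max ((\<lambda>z. w z x) ` Z) \<in> (\<lambda>z. w z x) ` Z"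
    using w_pos finite_Z by (intro Max_in) auto
  then obtain z where "z \<in> Z" "w z x = Max ((\<lambda>z. w z x) ` Z)"
    by auto
  then have "z \<in> maximizers x"
    using finite_Z by (auto simp: maximizers_def)
  then show ?thesis
    by blast
qed

text \<open>The maximal weight is positive, while two different centres of equal \<open>d\<close>
  never both have positive weight at one point.\<close>

lemma maximizers_inj: "x \<in> A \<Longrightarrow> inj_on d (maximizers x)"
proof (rule inj_onI, rule ccontr)
  fix z z' assume x: "x \<in> A" and z: "z \<in> maximizers x" "z' \<in> maximizers x" "d z = d z'" "z \<noteq> z'"
  obtain y where "y \<in> Z" "0 < w y x"
    using w_pos[OF x] by blast
  then have "0 < w z x" "0 < w z' x"
    using z by (auto simp: maximizers_def intro: less_le_trans)
  then show False
    using w_orthogonal[OF x, of z z'] z by (auto simp: maximizers_def)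
qed

lemma label_eqI:
  assumes "x \<in> A" "z \<in> maximizers x" "\<And>z'. z' \<in> maximizers x \<Longrightarrow> d z \<le> d z'"
  shows "label x = z"
  unfolding label_def
proof (rule the_equality)
  fix y assume "y \<in> maximizers x \<and> (\<forall>z'\<in>maximizers x. d y \<le> d z')"
  then show "y = z"
    using assms maximizers_inj[OF assms(1)] by (meson antisym inj_onD)
qed (use assms in blast)

lemma label: 
  assumes "x \<in> A"
  shows "label x \<in> maximizers x" "z \<in> maximizers x \<Longrightarrow> d (label x) \<le> d z"
proof -
  have "\<exists>y\<in>maximizers x. \<forall>z\<in>maximizers x. d y \<le> d z"
    using maximizers_nonempty[OF assms] ex_has_least_nat[of "\<lambda>z. z \<in> maximizers x" _ d] by blast
  then obtain y where y: "y \<in> maximizers x" "\<And>z. z \<in> maximizers x \<Longrightarrow> d y \<le> d z"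
    by blast
  have "label x = y"
    by (rule label_eqI[OF assms y])
  then show "label x \<in> maximizers x" "z \<in> maximizers x \<Longrightarrow> d (label x) \<le> d z"
    using y by auto
qed

lemma label_in: "x \<in> A \<Longrightarrow> label x \<in> Z"
  using label(1) by (auto simp: maximizers_def)

lemma label_translate:
  assumes act: "group_action G (topspace X) \<phi>" and g: "g \<in> carrier G" and x: "x \<in> A"
  shows "label (\<phi> g x) = \<phi> g (label x)"
proof -
  interpret group_action G "topspace X" \<phi>
    by (rule act)
  interpret grp: group G
    using group_hom by (simp add: group_hom_def)
  have one: "\<phi> \<one>\<^bsub>G\<^esub> y = y" if "y \<in> topspace X" for y
    using fun_cong[OF id_eq_one, of y] that by simp
  have inv: "\<phi> g (\<phi> (inv\<^bsub>G\<^esub> g) y) = y" if "y \<in> topspace X" for y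
    using composition_rule[OF that g grp.inv_closed[OF g]] one[OF that] g by simp
  have trans: "\<phi> g z \<in> maximizers (\<phi> g x) \<longleftrightarrow> z \<in> maximizers x" if z: "z \<in> Z" for z
  proof -
    have "w z' (\<phi> g x) = w (\<phi> (inv\<^bsub>G\<^esub> g) z') x \<and> \<phi> (inv\<^bsub>G\<^esub> g) z' \<in> Z" if "z' \<in> Z" for z'
    proof -
      have "z' \<in> topspace X"
        using that Z_sub A_sub by blast
      moreover have "\<phi> (inv\<^bsub>G\<^esub> g) z' \<in> Z"
        using that g by (intro Z_closed) auto
      ultimately show ?thesis
        using w_equivariant[OF g x, of "\<phi> (inv\<^bsub>G\<^esub> g) z'"] inv by simp
    qed
    moreover have "w (\<phi> g z') (\<phi> g x) = w z' x \<and> \<phi> g z' \<in> Z" if "z' \<in> Z" for z'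
      using that g x w_equivariant Z_closed by blast
    ultimately have "(\<forall>z'\<in>Z. w z' (\<phi> g x) \<le> w (\<phi> g z) (\<phi> g x)) \<longleftrightarrow> (\<forall>z'\<in>Z. w z' x \<le> w z x)"
      using z by metis
    then show ?thesis
      using z Z_closed[OF g z] by (simp add: maximizers_def)
  qed
  show ?thesis
  proof (rule label_eqI)
    show "\<phi> g x \<in> A"
      using g x by (rule A_closed)
    show "\<phi> g (label x) \<in> maximizers (\<phi> g x)"
      using trans label(1) label_in x by blast
    fix y assume y: "y \<in> maximizers (\<phi> g x)"
    then have yZ: "y \<in> Z"
      by (simp add: maximizers_def)
    then have y': "\<phi> g (\<phi> (inv\<^bsub>G\<^esub> g) y) = y" "\<phi> (inv\<^bsub>G\<^esub> g) y \<in> Z"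
      using inv[of y] Z_closed[OF grp.inv_closed[OF g] yZ] Z_sub A_sub by auto
    then have "d (label x) \<le> d (\<phi> (inv\<^bsub>G\<^esub> g) y)"
      using trans[OF y'(2)] y by (intro label(2)[OF x]) simp
    also have "\<dots> = d y"
      using d_invariant[OF g y'(2)] y'(1) by simp
    finally show "d (\<phi> g (label x)) \<le> d y"
      using d_invariant[OF g label_in[OF x]] by simp
  qed
qed

text \<open>By continuity of the weights, a centre that is not maximal at \<open>x\<close> is not
  maximal near \<open>x\<close>. So nearby labels belong to \<open>maximizers x\<close>, where
  \<open>d\<close> is injective.\<close>

lemma label_locally_inj:
  assumes "A = topspace X" "x \<in> topspace X"
  shows "\<exists>U. openin X U \<and> x \<in> U \<and> inj_on d (label ` U)"
proof -
  have x: "x \<in> A"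
    using assms by simp
  obtain z0 where z0: "z0 \<in> maximizers x"
    using maximizers_nonempty[OF x] by blast
  \<comment> \<open>Finitely many strict inequalities: on \<open>U\<close> the weight of
    \<open>z0\<close> beats that of every centre outside \<open>maximizers x\<close>. The
    intersection with \<open>topspace X\<close> is for an empty index set.\<close>
  define U where "U = (\<Inter>z\<in>Z - maximizers x. {y \<in> topspace X. w z0 y - w z y \<in> {0<..}}) \<inter> topspace X"
  have "openin X U"
    unfolding U_def
  proof (rule openin_INT)
    fix z assume "z \<in> Z - maximizers x"
    then have "continuous_map X euclideanreal (\<lambda>y. w z0 y - w z y)"
      using z0 w_cont assms(1) by (intro continuous_map_diff) (auto simp: maximizers_def)
    then show "openin X {y \<in> topspace X. w z0 y - w z y \<in> {0<..}}"
      by (rule openin_continuous_map_preimage) simp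
  qed (simp add: finite_Z)
  moreover have "x \<in> U"
    using assms(2) z0 by (auto simp: U_def maximizers_def)
  moreover have "label ` U \<subseteq> maximizers x"
  proof clarify
    fix y assume y: "y \<in> U"
    then have "y \<in> A"
      using assms(1) by (simp add: U_def)
    then have l: "label y \<in> maximizers y"
      by (rule label(1))
    show "label y \<in> maximizers x"
    proof (rule ccontr)
      assume "label y \<notin> maximizers x"
      then have "w (label y) y < w z0 y"
        using y l by (auto simp: U_def maximizers_def)
      then show False
        using l z0 by (auto simp: maximizers_def)
    qed
  qed
  ultimately show ?thesis
    using inj_on_subset[OF maximizers_inj[OF x]] by blast
qed

end

section \<open>Dihedral actions\<close>

lemma dihedral_group_facts:
  assumes "dihedral_group p G a b" "odd p" "p > 1"
  shows "group G" "a \<in> carrier G" "b \<in> carrier G" "a \<noteq> \<one>\<^bsub>G\<^esub>" "a [^]\<^bsub>G\<^esub> p = \<one>\<^bsub>G\<^esub>"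
    "b \<otimes>\<^bsub>G\<^esub> b = \<one>\<^bsub>G\<^esub>" "a \<otimes>\<^bsub>G\<^esub> b \<otimes>\<^bsub>G\<^esub> a = b" "finite (carrier G)" "generate G {a, b} = carrier G"
proof -
  interpret group G
    using assms(1) by (simp add: dihedral_group_def)
  show "group G"
    by unfold_locales
  show ab: "a \<in> carrier G" "b \<in> carrier G" and "a [^]\<^bsub>G\<^esub> p = \<one>\<^bsub>G\<^esub>"
    and gen: "generate G {a, b} = carrier G"
    using assms(1) by (auto simp: dihedral_group_def)
  show bb: "b \<otimes>\<^bsub>G\<^esub> b = \<one>\<^bsub>G\<^esub>"
    using assms(1) ab by (simp add: dihedral_group_def numeral_2_eq_2)
  have bab: "b \<otimes>\<^bsub>G\<^esub> a \<otimes>\<^bsub>G\<^esub> b = inv\<^bsub>G\<^esub> a" and card: "card (carrier G) = 2 * p"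
    using assms(1) by (auto simp: dihedral_group_def order_def)
  show "finite (carrier G)"
    using card assms(3) by (intro card_ge_0_finite) simp
  have "b \<otimes>\<^bsub>G\<^esub> a = b \<otimes>\<^bsub>G\<^esub> a \<otimes>\<^bsub>G\<^esub> (b \<otimes>\<^bsub>G\<^esub> b)"
    using ab by (simp add: bb)
  also have "\<dots> = inv\<^bsub>G\<^esub> a \<otimes>\<^bsub>G\<^esub> b"
    unfolding bab[symmetric] using ab by (simp add: m_assoc)
  finally have "a \<otimes>\<^bsub>G\<^esub> (b \<otimes>\<^bsub>G\<^esub> a) = a \<otimes>\<^bsub>G\<^esub> (inv\<^bsub>G\<^esub> a \<otimes>\<^bsub>G\<^esub> b)"
    by simp
  also have "\<dots> = a \<otimes>\<^bsub>G\<^esub> inv\<^bsub>G\<^esub> a \<otimes>\<^bsub>G\<^esub> b"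
    by (rule m_assoc[symmetric]) (use ab in auto)
  finally show "a \<otimes>\<^bsub>G\<^esub> b \<otimes>\<^bsub>G\<^esub> a = b"
    using ab by (simp add: m_assoc)
  show "a \<noteq> \<one>\<^bsub>G\<^esub>"
  proof
    assume a: "a = \<one>\<^bsub>G\<^esub>"
    \<comment> \<open>If a were trivial, this subgroup of order at most 2 would be all of G, whose
      order is 2p.\<close>
    have "subgroup {\<one>\<^bsub>G\<^esub>, b} G"
      using ab bb by (intro subgroupI) (auto simp: inv_equality)
    then have "generate G {a, b} \<subseteq> {\<one>\<^bsub>G\<^esub>, b}"
      using a by (intro generate_subgroup_incl) auto
    then have "card (carrier G) \<le> card {\<one>\<^bsub>G\<^esub>, b}"
      unfolding gen by (intro card_mono) auto
    also have "\<dots> \<le> 2"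
      by (simp add: card_insert_if)
    finally show False
      using card assms(3) by simp
  qed
qed

locale dihedral_sphere =
  fixes p k :: nat and G :: "('g, 'm) monoid_scheme" and a b :: 'g
    and X :: "'x topology" and \<phi> :: "'g \<Rightarrow> 'x \<Rightarrow> 'x"
  assumes p: "prime p" "odd p" and dihedral: "dihedral_group p G a b"
    and k: "k > 0" "even k"
    and CW: "finite_G_CW_complex G X \<phi>"
    and sphere: "X homotopy_equivalent_space nsphere (2 * k)"
    and no_fixed: "fixed_points G X \<phi> = {}"
    and pseudofree: "pseudofree G X \<phi>"
    and trivial: "trivial_on_homology G X \<phi>"
begin

lemmas group_facts = dihedral_group_facts[OF dihedral p(2) prime_gt_1_nat[OF p(1)]]

lemma G_space: "G_space G X \<phi>"
  using CW by (simp add: finite_G_CW_complex_def)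

sublocale act: group_action G "topspace X" \<phi>
  using G_space by (simp add: G_space_def)

sublocale group G
  by (rule group_facts)

lemma cont: "g \<in> carrier G \<Longrightarrow> continuous_map X X (\<phi> g)"
  using G_space by (simp add: G_space_def)

lemma closed: "g \<in> carrier G \<Longrightarrow> x \<in> topspace X \<Longrightarrow> \<phi> g x \<in> topspace X"
  by (rule act.element_image) auto

lemma \<phi>_one: "x \<in> topspace X \<Longrightarrow> \<phi> \<one>\<^bsub>G\<^esub> x = x"
  using fun_cong[OF act.id_eq_one, of x] by simp

lemma \<phi>_pow: "x \<in> topspace X \<Longrightarrow> (\<phi> a ^^ i) x = \<phi> (a [^]\<^bsub>G\<^esub> i) x"
proof (induction i)
  case (Suc i)
  have "a [^]\<^bsub>G\<^esub> Suc i = a \<otimes>\<^bsub>G\<^esub> a [^]\<^bsub>G\<^esub> i"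
    using group_facts(2) by (rule nat_pow_Suc2)
  then show ?case
    using Suc group_facts(2) by (simp add: act.composition_rule)
qed (simp add: \<phi>_one)

lemma \<phi>_period: "x \<in> topspace X \<Longrightarrow> (\<phi> a ^^ p) x = x"
  by (simp add: \<phi>_pow group_facts \<phi>_one)

lemma \<phi>_bb: "x \<in> topspace X \<Longrightarrow> \<phi> b (\<phi> b x) = x"
  using act.composition_rule[of x b b] by (simp add: group_facts \<phi>_one)

lemma \<phi>_aba: "x \<in> topspace X \<Longrightarrow> \<phi> a (\<phi> b (\<phi> a x)) = \<phi> b x"
  using act.composition_rule[of x "a \<otimes>\<^bsub>G\<^esub> b" a] act.composition_rule[of "\<phi> a x" a b]
  by (simp add: group_facts closed)

lemma not_both_fixed:
  assumes "x \<in> topspace X" "\<phi> a x = x" "\<phi> b x = x"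
  shows False
proof -
  have "subgroup (stabilizer G \<phi> x) G"
    by (rule act.stabilizer_subgroup[OF assms(1)])
  then have "generate G {a, b} \<subseteq> stabilizer G \<phi> x"
    using assms group_facts by (intro generate_subgroup_incl) (auto simp: stabilizer_def)
  then have "x \<in> fixed_points G X \<phi>"
    using assms(1) group_facts(9) by (auto simp: fixed_points_def stabilizer_def)
  then show False
    using no_fixed by simp
qed

sublocale dihedral_complex "\<lambda>n. {c. singular_chain n X c}" "\<lambda>n. chain_boundary (Suc n)"
  "\<lambda>n. chain_map n (\<phi> a)" p "2 * k" "\<lambda>n. chain_map n (\<phi> b)"
proof -
  interpret cyclic_complex "\<lambda>n. {c. singular_chain n X c}" "\<lambda>n. chain_boundary (Suc n)"
    "\<lambda>n. chain_map n (\<phi> a)" p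
    by (rule singular_cyclic_complex[OF cont[OF group_facts(2)] \<phi>_period])
  have triv: "chain_map (Suc n) (\<phi> g) c - c \<in> chain_boundary (Suc (Suc n)) ` {c. singular_chain (Suc (Suc n)) X c}"
    if "c \<in> {c. singular_chain (Suc n) X c}" "chain_boundary (Suc n) c = 0" "g \<in> carrier G" for n c g
    using trivial_on_homology_boundary[OF trivial G_space that(3), of "Suc n" c] that(1,2)
    by (metis imageI mem_Collect_eq)
  show "dihedral_complex (\<lambda>n. {c. singular_chain n X c}) (\<lambda>n. chain_boundary (Suc n))
      (\<lambda>n. chain_map n (\<phi> a)) p (2 * k) (\<lambda>n. chain_map n (\<phi> b))"
  proof unfold_locales
    show "exact_at n" if "Suc n \<noteq> 2 * k" for n
      unfolding exact_at_def using sphere_cycle_boundary[OF sphere] that by blast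
    show "chain_map n (\<phi> b) c \<in> {c. singular_chain n X c}" if "c \<in> {c. singular_chain n X c}" for n c
      using that cont[OF group_facts(3)] by (auto intro: singular_chain_chain_map)
    show "chain_boundary (Suc n) (chain_map (Suc n) (\<phi> b) c) = chain_map n (\<phi> b) (chain_boundary (Suc n) c)"
      if "c \<in> {c. singular_chain (Suc n) X c}" for n c
      using that chain_boundary_chain_map[of "Suc n" X c "\<phi> b"] by simp
    show "chain_map n (\<phi> a) (chain_map n (\<phi> b) (chain_map n (\<phi> a) c)) = chain_map n (\<phi> b) c"
      if "c \<in> {c. singular_chain n X c}" for n c
    proof -
      have "chain_map n (\<phi> a) (chain_map n (\<phi> b) (chain_map n (\<phi> a) c)) = chain_map n (\<phi> a \<circ> (\<phi> b \<circ> \<phi> a)) c"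
        unfolding chain_map_compose by simp
      also have "\<dots> = chain_map n (\<phi> b) c"
        using that by (intro chain_map_eq[of n X]) (auto simp: \<phi>_aba)
      finally show ?thesis .
    qed
  qed (use triv group_facts in \<open>auto simp: chain_map_diff\<close>)
qed

lemma path_exists:
  assumes "x \<in> topspace X" "y \<in> topspace X"
  shows "\<exists>c. singular_chain 1 X c \<and> chain_boundary 1 c = frag_of (point y) - frag_of (point x)"
  using sphere_points_homologous[OF sphere, of "frag_of (point y) - frag_of (point x)"] k assms
  by (simp add: singular_chain_of singular_simplex_point singular_chain_diff chain_map_diff simplex_map_point)

lemma impossible: False
proof -
  obtain D Z d w where "cell_weights G X \<phi> D (topspace X) Z d w"
    using finite_G_CW_complex_weights[OF CW group_facts(8) pseudofree] by blast
  then interpret W: cell_weights G X \<phi> D "topspace X" Z d w .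
  have Z: "z \<in> topspace X" if "z \<in> Z" for z
    using W.Z_sub that by blast
  have translate: "W.label (\<phi> g x) = \<phi> g (W.label x)" if "g \<in> carrier G" "x \<in> topspace X" for g x
    by (rule W.label_translate[OF act.group_action_axioms that])
  interpret L: labelled_space Z d "\<phi> a" p D X W.label
  proof
    show "\<phi> a z \<noteq> z" if "z \<in> Z" "0 < d z" for z
      using W.Z_free[of a z] that group_facts by blast
  qed (use Z W.Z_closed W.d_invariant W.d_less \<phi>_period p cont group_facts W.label_in translate
      W.label_locally_inj in auto)
  show False
  proof (cases "\<exists>x\<in>topspace X. \<phi> a x = x")
    case True
    then obtain x where x: "x \<in> topspace X" "\<phi> a x = x"
      by blast
    define y where "y = \<phi> b x"
    have y: "y \<in> topspace X" "\<phi> a y = y" "\<phi> b y = x"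
      using x \<phi>_aba[OF x(1)] closed \<phi>_bb group_facts(3) by (auto simp: y_def)
    obtain c1 where c1: "singular_chain 1 X c1" "chain_boundary 1 c1 = frag_of (point y) - frag_of (point x)"
      using path_exists[OF x(1) y(1)] by blast
    \<comment> \<open>Label chains vanish from degree \<open>D\<close> on; the maximum with 1 keeps
      \<open>c 1\<close> within the sequence.\<close>
    have "\<exists>c. chain_boundary (Suc 0) (c 1) = chain_boundary (Suc 0) c1 \<and> tate_seq 0 1 (max 1 D) c"
    proof (rule tate_seq_from_1)
      show "tate True 0 (chain_boundary (Suc 0) c1) = 0"
        using c1(2) x y by (simp add: tate_def chain_map_diff simplex_map_point)
      show "chain_map 0 (\<phi> b) (chain_boundary (Suc 0) c1) = - chain_boundary (Suc 0) c1"
        using c1(2) y by (simp add: chain_map_diff simplex_map_point flip: y_def)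
      show "4 dvd 2 * k"
        using k(2) by (auto elim!: evenE)
    qed (use c1 k p in auto)
    then obtain c where c: "chain_boundary 1 (c 1) = frag_of (point y) - frag_of (point x)"
      "tate_seq 0 1 (max 1 D) c"
      using c1(2) by auto
    \<comment> \<open>The absence of global fixed points is applied to the label of
      \<open>x\<close>, a point of X: it is fixed by a as \<open>x\<close> is, and would be fixed by
      b if both labels agreed.\<close>
    have "W.label x \<noteq> W.label y"
    proof
      assume "W.label x = W.label y"
      then have "\<phi> b (W.label x) = W.label x" "\<phi> a (W.label x) = W.label x"
        using translate[of b x] translate[of a x] x group_facts by (auto simp: y_def)
      then show False
        using not_both_fixed[OF Z[OF W.label_in[OF x(1)]]] by blast
    qed
    with L.no_singular_tate_seq_from_1[OF c(2) _ _ x(1) y(1)] c(1) x(2) show False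
      by simp
  next
    case False
    obtain x where x: "x \<in> topspace X"
      using sphere_nonempty[OF sphere] by blast
    have "\<exists>c. c 0 = frag_of (point x) \<and> tate_seq 1 0 D c"
    proof (rule tate_seq_from_0)
      show "frag_of (point x) \<in> {c. singular_chain 0 X c}"
        using x by (simp add: singular_chain_of singular_simplex_point)
      show "chain_map 0 (\<phi> a) (frag_of (point x)) - frag_of (point x) \<in> chain_boundary (Suc 0) ` {c. singular_chain (Suc 0) X c}"
        using path_exists[OF x closed[OF group_facts(2) x]] by (force simp: simplex_map_point)
      show "c \<in> chain_boundary (Suc (2 * k)) ` {c. singular_chain (Suc (2 * k)) X c}"
        if "Suc n = 2 * k" "c \<in> {c. singular_chain (2 * k) X c}" "chain_boundary (Suc n) c = 0"
          "(\<Sum>i<p. c) \<in> chain_boundary (Suc (2 * k)) ` {c. singular_chain (Suc (2 * k)) X c}" for n c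
      proof -
        have "singular_relboundary (2 * k) X {} (\<Sum>i<p. c)"
          using that(4) by (auto simp: singular_boundary)
        moreover have "chain_boundary (2 * k) c = 0"
          using that(3) unfolding that(1) .
        ultimately have "singular_relboundary (2 * k) X {} c"
          using sphere_torsion_free[OF sphere, of c p] that(2) k(1) prime_gt_0_nat[OF p(1)] by simp
        then show ?thesis
          by (auto simp: singular_boundary)
      qed
    qed (use k in auto)
    then obtain c where "c 0 = frag_of (point x)" "tate_seq 1 0 D c"
      by blast
    \<comment> \<open>Labels are points of X, so a moves all of them and the exactness on labels
      holds in degree 0 too.\<close>
    then show False
      using L.no_singular_tate_seq_from_0[of D c x] False x Z by auto
  qed
qed

end

theorem corollary2p8:
  fixes p k :: nat and G :: "('g, 'm) monoid_scheme" and a b :: 'g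
  assumes "prime p" and "odd p"
    and "dihedral_group p G a b"
    and "k > 0" and "even k"
  shows "\<not> (\<exists>(X :: 'x topology) \<phi>.
            finite_G_CW_complex G X \<phi> \<and>
            X homotopy_equivalent_space nsphere (2 * k) \<and>
            fixed_points G X \<phi> = {} \<and>
            faithful_action G (topspace X) \<phi> \<and>
            pseudofree G X \<phi> \<and>
            trivial_on_homology G X \<phi>)"
proof
  assume "\<exists>(X :: 'x topology) \<phi>.
            finite_G_CW_complex G X \<phi> \<and>
            X homotopy_equivalent_space nsphere (2 * k) \<and>
            fixed_points G X \<phi> = {} \<and>
            faithful_action G (topspace X) \<phi> \<and>
            pseudofree G X \<phi> \<and>
            trivial_on_homology G X \<phi>"
  then obtain X :: "'x topology" and \<phi> where "dihedral_sphere p k G a b X \<phi>"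
    using assms by (auto simp: dihedral_sphere_def)
  then show False
    by (rule dihedral_sphere.impossible)
qed

end
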